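(* Let $A\subseteq S^{n-1}$ be a measurable set with $\sigma_{n-1}(A)>0$. Let $2\leq k\leq n-1$, and let $H\subseteq \mathbb{R}^n$ be a random subspace of dimension $k$. Then $$\mathrm{Var}\left(\frac{\sigma_H(A\cap H)}{\sigma_{n-1}(A)}\right)\leq \frac{n-k}{k(n-1)}\left(\frac{1}{\sigma_{n-1}(A)}-1\right).$$
   Context: $S^{n-1}$ is the unit sphere in $\mathbb{R}^n$; $\sigma_{n-1}$ and $\sigma_H$ are the rotation invariant probability measures on $S^{n-1}$ and $S^{n-1}\cap H$ respectively. A random subspace of dimension $k$ is a linear subspace distributed according to the rotation invariant probability measure on the Grassmannian $G_{n,k}$ of $k$-dimensional linear subspaces of $\mathbb{R}^n$. *)

theory Defs
  imports "HOL-Probability.Probability"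
begin

text \<open>
  ``Rotation invariant'' is read as invariant under the full orthogonal group.  Every linear
  isometry of a subspace \<open>H\<close> extends to one of the whole space, so below the invariance is
  under all linear isometries of \<open>H\<close>, and \<open>\<mu>\<close> is the unique such Borel probability measure
  on \<open>sphere 0 1 \<inter> H\<close> (for \<open>dim H \<ge> 1\<close>).  The case \<open>H = UNIV\<close> is the unit sphere itself.
\<close>

definition rotation_invariant_on_sphere :: "'a::euclidean_space set \<Rightarrow> 'a measure \<Rightarrow> bool" where
  "rotation_invariant_on_sphere H \<mu> \<longleftrightarrow>
     prob_space \<mu> \<and>
     sets \<mu> = sets (restrict_space borel (sphere 0 1 \<inter> H)) \<and>
     (\<forall>f. orthogonal_transformation f \<and> f ` H = H \<longrightarrow> distr \<mu> \<mu> f = \<mu>)"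

definition grassmannian :: "nat \<Rightarrow> 'a::euclidean_space set set" where
  "grassmannian k = {H. subspace H \<and> dim H = k}"

definition orth_proj :: "'a::euclidean_space set \<Rightarrow> 'a \<Rightarrow>\<^sub>L 'a" where
  "orth_proj H = Blinfun (closest_point H)"

lemma closest_point_orth_decomp:
  fixes H :: "'a::euclidean_space set"
  assumes "subspace H"
  shows "closest_point H x \<in> H" and "y \<in> H \<Longrightarrow> (x - closest_point H x) \<bullet> y = 0"
proof -
  have cl: "closed H" and cv: "convex H" and ne: "H \<noteq> {}"
    using assms by (auto simp: closed_subspace subspace_imp_convex dest: subspace_0)
  show mem: "closest_point H x \<in> H"
    using closest_point_in_set[OF cl ne] .
  show "(x - closest_point H x) \<bullet> y = 0" if "y \<in> H"
  proof -
    let ?p = "closest_point H x"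
    have "?p + y \<in> H" "?p - y \<in> H"
      using assms mem that by (auto intro: subspace_add subspace_diff)
    from this[THEN closest_point_dot[OF cv cl, where a = x]]
    show ?thesis by simp
  qed
qed

lemma closest_point_eqI:
  fixes H :: "'a::euclidean_space set"
  assumes "subspace H" "p \<in> H" "\<And>y. y \<in> H \<Longrightarrow> (x - p) \<bullet> y = 0"
  shows "closest_point H x = p"
proof -
  let ?d = "closest_point H x - p"
  have d: "?d \<in> H"
    using assms closest_point_orth_decomp(1)[of H x] by (auto intro: subspace_diff)
  have "(x - p) \<bullet> ?d - (x - closest_point H x) \<bullet> ?d = 0"
    using assms(3)[OF d] closest_point_orth_decomp(2)[OF assms(1) d, of x] by simp
  hence "?d \<bullet> ?d = 0"
    by (simp add: inner_diff_left)
  thus ?thesis by simp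
qed

lemma orth_proj_apply:
  fixes H :: "'a::euclidean_space set"
  assumes "subspace H"
  shows "blinfun_apply (orth_proj H) = closest_point H"
proof -
  note D = closest_point_orth_decomp[OF assms]
  have "linear (closest_point H)"
  proof
    show "closest_point H (x + y) = closest_point H x + closest_point H y" for x y
    proof (rule closest_point_eqI[OF assms])
      fix z assume z: "z \<in> H"
      show "(x + y - (closest_point H x + closest_point H y)) \<bullet> z = 0"
        using D(2)[OF z, of x] D(2)[OF z, of y] by (simp add: inner_diff_left inner_add_left)
    qed (use assms D(1) in \<open>auto intro: subspace_add\<close>)
    show "closest_point H (r *\<^sub>R x) = r *\<^sub>R closest_point H x" for r x
    proof (rule closest_point_eqI[OF assms])
      fix z assume z: "z \<in> H"
      show "(r *\<^sub>R x - r *\<^sub>R closest_point H x) \<bullet> z = 0"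
        using D(2)[OF z, of x] by (simp add: inner_diff_left)
    qed (use assms D(1) in \<open>auto intro: subspace_scale\<close>)
  qed
  thus ?thesis
    unfolding orth_proj_def
    by (intro bounded_linear_Blinfun_apply) (simp add: linear_conv_bounded_linear)
qed

text \<open>
  The Borel sigma-algebra of the usual topology on the Grassmannian, i.e. that of the metric
  \<open>norm (orth_proj H - orth_proj K)\<close> (operator norm).
\<close>

definition grassmannian_borel :: "nat \<Rightarrow> 'a::euclidean_space set measure" where
  "grassmannian_borel k = vimage_algebra (grassmannian k) orth_proj borel"

definition rotation_invariant_on_grassmannian ::
  "nat \<Rightarrow> 'a::euclidean_space set measure \<Rightarrow> bool" where
  "rotation_invariant_on_grassmannian k \<nu> \<longleftrightarrow>
     prob_space \<nu> \<and>
     sets \<nu> = sets (grassmannian_borel k) \<and>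
     (\<forall>f. orthogonal_transformation f \<longrightarrow> distr \<nu> \<nu> (\<lambda>H. f ` H) = \<nu>)"

definition random_subspace :: "'w measure \<Rightarrow> nat \<Rightarrow> ('w \<Rightarrow> 'a::euclidean_space set) \<Rightarrow> bool" where
  "random_subspace M k H \<longleftrightarrow>
     H \<in> M \<rightarrow>\<^sub>M grassmannian_borel k \<and>
     rotation_invariant_on_grassmannian k (distr M (grassmannian_borel k) H)"

end

theory Submission
  imports Defs
begin

text \<open>
  Let \<open>T f (H)\<close> be the mean of \<open>f\<close> over the section of the sphere by \<open>H\<close>, let \<open>n\<close> be the
  dimension, and let \<open>P\<close> denote the orthogonal projection onto \<open>H\<close>.  The claim says that
  \<open>T* T\<close> is bounded by \<open>(n - k) / (k (n - 1))\<close> on mean-zero functions.  For a unit vector \<open>a\<close>,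
  \<open>T\<close> maps \<open>(a \<bullet> x) ^ d\<close> to a constant times \<open>\<bar>P a\<bar> ^ d\<close>, and by invariance the mean of
  \<open>\<bar>a - P a\<bar> ^ (2 i)\<close> given that \<open>x\<close> lies in \<open>H\<close> is a constant times \<open>(1 - (a \<bullet> x)\<^sup>2) ^ i\<close>.
  Expanding \<open>\<bar>P a\<bar> ^ d = (1 - \<bar>a - P a\<bar>\<^sup>2) ^ (d / 2)\<close> for even \<open>d\<close> (odd powers are killed) shows
  that \<open>T* T\<close> is triangular with respect to the degree on the span of the functions
  \<open>(a \<bullet> x) ^ d\<close>.  The diagonal entry in degree \<open>d > 0\<close> is the product of a moment of order \<open>d\<close>
  of a coordinate on the sphere of \<open>H\<close>, which is at most \<open>1 / k\<close>, and a constant which is at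
  most \<open>(n - k) / (n - 1)\<close>.  As \<open>T* T\<close> is symmetric, these entries bound its norm.
\<close>

subsection \<open>Orthogonal transformations and projections\<close>

text \<open>The powers \<open>(a \<bullet> x) ^ d\<close> are used rather than spherical harmonics
  because T is explicit on them. They are not orthogonal, and a triangular form alone does not bound
  a norm. What it does bound is the exponential growth rate of the iterates of \<open>T* T\<close>;
  symmetry then makes a single application no larger than that rate. Functions have to be centred
  because constants are fixed. The constant of the theorem is the diagonal entry in degree 2, the
  lowest positive degree that survives the symmetry \<open>x \<mapsto> - x\<close>. A second
  obstacle is that the measures on the sections are known only through their invariance, with
  neither a disintegration nor measurable dependence on the subspace at hand. Conditioning on
  \<open>x \<in> H\<close> is therefore replaced by an identity between moments of two random
  orthogonal pairs, and measurability is read off explicit formulas and carried to indicators by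
  limits.\<close>

definition hyperplane_reflection :: "'a::real_inner \<Rightarrow> 'a \<Rightarrow> 'a" where
  "hyperplane_reflection v x = x - (2 * (x \<bullet> v) / (v \<bullet> v)) *\<^sub>R v"

lemma orthogonal_transformation_hyperplane_reflection:
  "orthogonal_transformation (hyperplane_reflection v)"
  unfolding orthogonal_transformation_def
proof (intro conjI allI)
  show "linear (hyperplane_reflection v)"
    by (rule linearI)
      (simp_all add: hyperplane_reflection_def inner_add_left algebra_simps add_divide_distrib)
  show "hyperplane_reflection v x \<bullet> hyperplane_reflection v y = x \<bullet> y" for x y
    by (cases "v = 0")
      (simp_all add: hyperplane_reflection_def inner_diff_left inner_diff_right inner_commute)
qed

text \<open>For points of equal length \<open>p - q\<close> is normal to their bisecting hyperplane.
  If \<open>p = q\<close> it is zero and the map degenerates to the identity.\<close>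

lemma hyperplane_reflection_swap:
  assumes "norm p = norm q"
  shows "hyperplane_reflection (p - q) p = q"
proof (cases "p = q")
  case False
  have "2 * (p \<bullet> (p - q)) = (p - q) \<bullet> (p - q)"
    using assms by (simp add: norm_eq inner_diff_left inner_diff_right inner_commute)
  with False show ?thesis
    by (simp add: hyperplane_reflection_def)
qed (simp add: hyperplane_reflection_def)

lemma hyperplane_reflection_fix: "x \<bullet> v = 0 \<Longrightarrow> hyperplane_reflection v x = x"
  by (simp add: hyperplane_reflection_def)

lemma hyperplane_reflection_involution:
  "hyperplane_reflection v (hyperplane_reflection v x) = x"
  by (cases "v = 0") (simp_all add: hyperplane_reflection_def inner_diff_left)

lemma hyperplane_reflection_image:
  assumes "subspace K" "v \<in> K"
  shows "hyperplane_reflection v ` K = K"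
proof -
  have sub: "hyperplane_reflection v ` K \<subseteq> K"
    using assms by (auto simp: hyperplane_reflection_def intro: subspace_diff subspace_scale)
  moreover have "K \<subseteq> hyperplane_reflection v ` K"
  proof
    fix x assume "x \<in> K"
    hence "hyperplane_reflection v x \<in> K" using sub by blast
    thus "x \<in> hyperplane_reflection v ` K"
      by (intro image_eqI[of _ _ "hyperplane_reflection v x"])
        (simp_all add: hyperplane_reflection_involution)
  qed
  ultimately show ?thesis by blast
qed

lemma orthogonal_transformation_between_pairs:
  fixes p q p' q' :: "'a::real_inner"
  assumes "p \<bullet> q = 0" "p' \<bullet> q' = 0" "norm p = norm p'" "norm q = norm q'"
  obtains g where "orthogonal_transformation g" "g p = p'" "g q = q'"
proof -
  let ?r = "hyperplane_reflection (p - p')"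
  let ?s = "hyperplane_reflection (?r q - q')"
  have r: "orthogonal_transformation ?r" "?r p = p'"
    using orthogonal_transformation_hyperplane_reflection hyperplane_reflection_swap[OF assms(3)] by blast+
  have "p' \<bullet> ?r q = 0"
    using r(1) assms(1) unfolding orthogonal_transformation_def by (subst r(2)[symmetric]) simp
  hence "?s p' = p'"
    using assms hyperplane_reflection_fix[of p' "?r q - q'"] by (simp add: inner_diff_right)
  moreover have "?s (?r q) = q'"
    using hyperplane_reflection_swap[of "?r q" q'] orthogonal_transformation_norm[OF r(1), of q] assms(4)
    by simp
  ultimately show ?thesis
    using r that[of "?s \<circ> ?r"] orthogonal_transformation_compose[OF _ r(1)]
      orthogonal_transformation_hyperplane_reflection by (metis comp_apply)
qed

lemma closest_point_subspace_inner:
  fixes K :: "'a::euclidean_space set"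
  assumes "subspace K"
  shows "y \<in> K \<Longrightarrow> closest_point K x \<bullet> y = x \<bullet> y"
    and "closest_point K x \<bullet> z = x \<bullet> closest_point K z"
    and "closest_point K x \<bullet> x = (norm (closest_point K x))\<^sup>2"
    and "(norm (x - closest_point K x))\<^sup>2 = (norm x)\<^sup>2 - (norm (closest_point K x))\<^sup>2"
    and "norm (closest_point K x) \<le> norm x"
proof -
  note D = closest_point_orth_decomp[OF assms]
  show 1: "closest_point K x \<bullet> y = x \<bullet> y" if "y \<in> K" for x y
    using D(2)[OF that, of x] by (simp add: inner_diff_left)
  show 2: "closest_point K x \<bullet> z = x \<bullet> closest_point K z" for x z
    using 1[OF D(1), of x z] 1[OF D(1), of z x] by (simp add: inner_commute)
  show 3: "closest_point K x \<bullet> x = (norm (closest_point K x))\<^sup>2"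
    using 1[OF D(1), of x x] by (simp add: power2_norm_eq_inner inner_commute)
  show 4: "(norm (x - closest_point K x))\<^sup>2 = (norm x)\<^sup>2 - (norm (closest_point K x))\<^sup>2"
    using 3 by (simp add: power2_norm_eq_inner inner_diff_left inner_diff_right inner_commute)
  have "(norm (closest_point K x))\<^sup>2 \<le> (norm x)\<^sup>2"
    using 4 zero_le_power2[of "norm (x - closest_point K x)"] by linarith
  thus "norm (closest_point K x) \<le> norm x"
    by (simp add: abs_le_square_iff[symmetric])
qed

lemma linear_closest_point_subspace:
  fixes K :: "'a::euclidean_space set"
  assumes "subspace K"
  shows "linear (closest_point K)"
  using blinfun.bounded_linear_right[of "orth_proj K"]
  by (simp add: orth_proj_apply[OF assms] bounded_linear.linear)

lemma closest_point_orthogonal_image: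
  fixes K :: "'a::euclidean_space set" and g :: "'a \<Rightarrow> 'a"
  assumes K: "subspace K" and g: "orthogonal_transformation g"
  shows "closest_point (g ` K) (g x) = g (closest_point K x)"
proof (rule closest_point_eqI)
  have lin: "linear g" and inner: "g u \<bullet> g v = u \<bullet> v" for u v
    using g by (auto simp: orthogonal_transformation_def)
  show "subspace (g ` K)"
    by (rule linear_subspace_image[OF lin K])
  show "g (closest_point K x) \<in> g ` K"
    using closest_point_orth_decomp(1)[OF K] by auto
  show "(g x - g (closest_point K x)) \<bullet> y = 0" if "y \<in> g ` K" for y
    using that closest_point_orth_decomp(2)[OF K]
    by (auto simp: inner linear_diff[OF lin, symmetric])
qed

text \<open>An isometry of \<open>S\<close> onto \<open>T\<close> is glued to one between the
  orthogonal complements. This transitivity is why sphere averages involving a projection depend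
  only on the dimension of the subspace.\<close>

lemma orthogonal_transformation_between_subspaces:
  fixes S T :: "'a::euclidean_space set"
  assumes S: "subspace S" and T: "subspace T" and "dim S = dim T"
  obtains g where "orthogonal_transformation g" "g ` S = T"
proof -
  define S' where "S' = {y \<in> UNIV. \<forall>x\<in>S. orthogonal x y}"
  define T' where "T' = {y \<in> UNIV. \<forall>x\<in>T. orthogonal x y}"
  have S': "subspace S'" and T': "subspace T'"
    by (auto simp: S'_def T'_def subspace_orthogonal_to_vectors)
  have "dim S' = dim T'"
    using dim_subspace_orthogonal_to_vectors[OF S subspace_UNIV]
      dim_subspace_orthogonal_to_vectors[OF T subspace_UNIV] assms(3)
    by (simp add: S'_def T'_def)
  then obtain f' where f': "linear f'" "f' ` S' = T'" "\<And>x. x \<in> S' \<Longrightarrow> norm (f' x) = norm x"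
    using isometries_subspaces[OF S' T'] by metis
  obtain f where f: "linear f" "f ` S = T" "\<And>x. x \<in> S \<Longrightarrow> norm (f x) = norm x"
    using isometries_subspaces[OF S T] assms(3) by metis
  define g where "g x = f (closest_point S x) + f' (x - closest_point S x)" for x
  note lin = linear_closest_point_subspace[OF S]
  have mem: "closest_point S x \<in> S" "x - closest_point S x \<in> S'" for x
    using closest_point_orth_decomp[OF S]
    by (auto simp: S'_def orthogonal_def inner_commute)
  have "linear g"
    by (rule linearI)
      (simp_all add: g_def linear_add[OF lin] linear_scale[OF lin] linear_diff[OF f'(1)]
        linear_add[OF f(1)] linear_scale[OF f(1)] linear_add[OF f'(1)] linear_scale[OF f'(1)] algebra_simps)
  moreover have "norm (g x) = norm x" for x
  proof -
    have "orthogonal (f (closest_point S x)) (f' (x - closest_point S x))"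
      using mem[of x] f(2) f'(2) by (auto simp: T'_def)
    hence "(norm (g x))\<^sup>2 = (norm (closest_point S x))\<^sup>2 + (norm (x - closest_point S x))\<^sup>2"
      unfolding g_def using mem[of x] f(3) f'(3) by (simp add: norm_add_Pythagorean)
    also have "\<dots> = (norm x)\<^sup>2"
      using closest_point_subspace_inner(4)[OF S] by simp
    finally show ?thesis by simp
  qed
  moreover have "g x = f x" if "x \<in> S" for x
    using that closest_point_self[OF that] f'(1) by (simp add: g_def linear_0)
  hence "g ` S = T"
    using f(2) by (simp cong: image_cong)
  ultimately show ?thesis
    using that by (auto simp: orthogonal_transformation)
qed

subsection \<open>Moments of rotation invariant measures on spheres\<close>

context
  fixes K :: "'a::euclidean_space set" and \<mu> :: "'a measure"
  assumes inv: "rotation_invariant_on_sphere K \<mu>"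
begin

lemma rotation_invariant_prob_space: "prob_space \<mu>"
  using inv by (simp add: rotation_invariant_on_sphere_def)

lemma sets_rotation_invariant: "sets \<mu> = sets (restrict_space borel (sphere 0 1 \<inter> K))"
  using inv by (simp add: rotation_invariant_on_sphere_def)

lemma space_rotation_invariant: "space \<mu> = sphere 0 1 \<inter> K"
  using sets_eq_imp_space_eq[OF sets_rotation_invariant] by (simp add: space_restrict_space)

lemma measurable_rotation_invariant:
  assumes "f \<in> borel \<rightarrow>\<^sub>M N"
  shows "f \<in> \<mu> \<rightarrow>\<^sub>M N"
  using measurable_restrict_space1[OF assms] by (simp cong: measurable_cong_sets[OF sets_rotation_invariant refl])

lemma integrable_rotation_invariant:
  fixes f :: "'a \<Rightarrow> real"
  assumes "f \<in> borel_measurable borel" "\<And>x. x \<in> sphere 0 1 \<Longrightarrow> \<bar>f x\<bar> \<le> C"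
  shows "integrable \<mu> f"
proof -
  interpret prob_space \<mu> by (rule rotation_invariant_prob_space)
  show ?thesis
    using assms by (intro integrable_const_bound[of _ C] measurable_rotation_invariant AE_I2)
      (auto simp: space_rotation_invariant)
qed

lemma integrable_rotation_invariant_continuous:
  fixes f :: "'a \<Rightarrow> real"
  assumes "continuous_on UNIV f"
  shows "integrable \<mu> f"
proof -
  have "compact (f ` sphere 0 1)"
    by (intro compact_continuous_image continuous_on_subset[OF assms]) auto
  then obtain C where "\<And>x. x \<in> sphere 0 1 \<Longrightarrow> \<bar>f x\<bar> \<le> C"
    by (force dest!: compact_imp_bounded simp: bounded_iff)
  thus ?thesis
    using assms by (intro integrable_rotation_invariant borel_measurable_continuous_onI)
qed

lemma integral_rotation_invariant:
  fixes f :: "'a \<Rightarrow> real" and g :: "'a \<Rightarrow> 'a"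
  assumes g: "orthogonal_transformation g" "g ` K = K" and f: "f \<in> borel_measurable borel"
  shows "(\<integral>x. f (g x) \<partial>\<mu>) = (\<integral>x. f x \<partial>\<mu>)"
proof -
  have lin: "linear g" using g(1) by (rule orthogonal_transformation_linear)
  have "g \<in> borel \<rightarrow>\<^sub>M borel"
    using lin by (intro borel_measurable_continuous_onI linear_continuous_on)
      (simp add: linear_conv_bounded_linear)
  hence "g \<in> restrict_space borel (sphere 0 1 \<inter> K) \<rightarrow>\<^sub>M restrict_space borel (sphere 0 1 \<inter> K)"
    using g by (intro measurable_restrict_space3)
      (auto simp: orthogonal_transformation_norm)
  hence "g \<in> \<mu> \<rightarrow>\<^sub>M \<mu>"
    by (simp cong: measurable_cong_sets[OF sets_rotation_invariant sets_rotation_invariant])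
  hence "(\<integral>x. f x \<partial>distr \<mu> \<mu> g) = (\<integral>x. f (g x) \<partial>\<mu>)"
    by (rule integral_distr) (rule measurable_rotation_invariant[OF f])
  thus ?thesis
    using inv g by (simp add: rotation_invariant_on_sphere_def)
qed

end

text \<open>The moment of order \<open>e\<close> of a coordinate on the sphere of the subspace.
  Averaging over \<open>y\<close> as well spares the choice of a unit vector, since the inner
  integral is constant in \<open>y\<close>.\<close>

definition sphere_moment :: "'a::euclidean_space measure \<Rightarrow> nat \<Rightarrow> real" where
  "sphere_moment \<mu> e = (\<integral>y. (\<integral>x. (y \<bullet> x) ^ e \<partial>\<mu>) \<partial>\<mu>)"

context
  fixes K :: "'a::euclidean_space set" and \<mu> :: "'a measure"
  assumes K: "subspace K" and inv: "rotation_invariant_on_sphere K \<mu>"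
begin

interpretation prob_space \<mu>
  by (rule rotation_invariant_prob_space[OF inv])

text \<open>For \<open>x\<close> in \<open>K\<close> only the projection of \<open>b\<close>
  matters, reflections inside \<open>K\<close> show that only its length does, and homogeneity
  extracts the power.\<close>

lemma integral_inner_power:
  "(\<integral>x. (b \<bullet> x) ^ e \<partial>\<mu>) = sphere_moment \<mu> e * norm (closest_point K b) ^ e"
proof -
  let ?I = "\<lambda>p. \<integral>x. (p \<bullet> x) ^ e \<partial>\<mu>"
  have I_cong: "?I p = ?I q" if pq: "p \<in> K" "q \<in> K" "norm p = norm q" for p q
  proof -
    let ?g = "hyperplane_reflection (p - q)"
    have "?I q = (\<integral>x. (q \<bullet> ?g x) ^ e \<partial>\<mu>)"
      using pq K by (intro integral_rotation_invariant[OF inv, symmetric])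
        (auto intro!: orthogonal_transformation_hyperplane_reflection
          hyperplane_reflection_image subspace_diff)
    moreover have "q \<bullet> ?g x = p \<bullet> x" for x
      using orthogonal_transformation_hyperplane_reflection[of "p - q"]
        hyperplane_reflection_swap[OF pq(3)]
      unfolding orthogonal_transformation_def by metis
    ultimately show ?thesis by simp
  qed
  obtain y where y: "y \<in> K" "norm y = 1"
    using not_empty space_rotation_invariant[OF inv] by auto
  have "sphere_moment \<mu> e = (\<integral>z. ?I y \<partial>\<mu>)"
    unfolding sphere_moment_def
    using y by (intro Bochner_Integration.integral_cong refl I_cong)
      (auto simp: space_rotation_invariant[OF inv])
  hence m: "sphere_moment \<mu> e = ?I y" by (simp add: prob_space)
  let ?p = "closest_point K b"
  have "?I b = ?I ?p"
    using closest_point_subspace_inner(1)[OF K]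
    by (intro Bochner_Integration.integral_cong) (auto simp: space_rotation_invariant[OF inv])
  also have "\<dots> = ?I (norm ?p *\<^sub>R y)"
    using y K closest_point_orth_decomp(1)[OF K] by (intro I_cong) (auto intro: subspace_scale)
  also have "\<dots> = norm ?p ^ e * ?I y"
    by (simp add: power_mult_distrib)
  finally show ?thesis by (simp add: m)
qed

lemma sphere_moment_eq:
  assumes "u \<in> K" "norm u = 1"
  shows "sphere_moment \<mu> e = (\<integral>x. (u \<bullet> x) ^ e \<partial>\<mu>)"
  using assms by (simp add: integral_inner_power closest_point_self)

lemma unit_vector_in_rotation_invariant: obtains u where "u \<in> K" "norm u = 1"
  using not_empty space_rotation_invariant[OF inv] by auto

lemma sphere_moment_0: "sphere_moment \<mu> 0 = 1"
  by (simp add: sphere_moment_def prob_space)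

lemma sphere_moment_odd:
  assumes "odd e"
  shows "sphere_moment \<mu> e = 0"
proof -
  obtain u where u: "u \<in> K" "norm u = 1" by (rule unit_vector_in_rotation_invariant)
  have "uminus ` K = K"
    using K by (force simp: image_iff intro: subspace_neg bexI[of _ "- _"])
  hence "(\<integral>x. (u \<bullet> - x) ^ e \<partial>\<mu>) = (\<integral>x. (u \<bullet> x) ^ e \<partial>\<mu>)"
    by (intro integral_rotation_invariant[OF inv]) (simp_all add: orthogonal_transformation_neg)
  thus ?thesis
    using assms by (simp add: sphere_moment_eq[OF u])
qed

text \<open>The squared coordinates in an orthonormal basis of \<open>K\<close> add up to 1, and all
  have the same mean.\<close>

lemma sphere_moment_2: "sphere_moment \<mu> 2 * dim K = 1"
proof -
  obtain B where B: "B \<subseteq> K" "pairwise orthogonal B" "\<And>x. x \<in> B \<Longrightarrow> norm x = 1"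
    "independent B" "card B = dim K" "span B = K"
    using orthonormal_basis_subspace[OF K] by metis
  have fin: "finite B" using B by (auto intro: independent_imp_finite)
  have *: "(\<Sum>b\<in>B. (b \<bullet> x)\<^sup>2) = 1" if "x \<in> space \<mu>" for x
  proof -
    have x: "x \<in> K" "norm x = 1"
      using that by (auto simp: space_rotation_invariant[OF inv])
    have "x = (\<Sum>b\<in>B. (b \<bullet> x) *\<^sub>R b)"
      using orthonormal_basis_expand[OF B(2) B(3), of x] x(1) B(6) fin by (simp add: inner_commute)
    hence "x \<bullet> x = x \<bullet> (\<Sum>b\<in>B. (b \<bullet> x) *\<^sub>R b)" by simp
    also have "\<dots> = (\<Sum>b\<in>B. (b \<bullet> x)\<^sup>2)"
      by (simp add: inner_sum_right power2_eq_square inner_commute)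
    finally show ?thesis using x(2) by (simp add: norm_eq_1)
  qed
  have "1 = (\<integral>x. (\<Sum>b\<in>B. (b \<bullet> x)\<^sup>2) \<partial>\<mu>)"
    using * by (simp add: prob_space cong: Bochner_Integration.integral_cong)
  also have "\<dots> = (\<Sum>b\<in>B. (\<integral>x. (b \<bullet> x)\<^sup>2 \<partial>\<mu>))"
    by (intro Bochner_Integration.integral_sum integrable_rotation_invariant_continuous[OF inv] continuous_intros)
  also have "\<dots> = (\<Sum>b\<in>B. sphere_moment \<mu> 2)"
    using B by (intro sum.cong refl sphere_moment_eq[symmetric]) auto
  finally show ?thesis using B(5) by (simp add: mult.commute)
qed

lemma sphere_moment_even_le:
  assumes "even e" "e \<ge> 2"
  shows "sphere_moment \<mu> e \<le> sphere_moment \<mu> 2"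
proof -
  obtain u where u: "u \<in> K" "norm u = 1" by (rule unit_vector_in_rotation_invariant)
  show ?thesis
    unfolding sphere_moment_eq[OF u]
  proof (rule integral_mono)
    fix x assume "x \<in> space \<mu>"
    hence "norm x = 1" by (auto simp: space_rotation_invariant[OF inv])
    hence "\<bar>u \<bullet> x\<bar> \<le> 1" using Cauchy_Schwarz_ineq2[of u x] u by simp
    thus "(u \<bullet> x) ^ e \<le> (u \<bullet> x)\<^sup>2"
      using power_decreasing[of 2 e "\<bar>u \<bullet> x\<bar>"] assms by (simp add: power_even_abs)
  qed (intro integrable_rotation_invariant_continuous[OF inv] continuous_intros)+
qed

text \<open>Were an even moment zero, the coordinate would vanish almost everywhere, and with it the
  second moment.\<close>

lemma sphere_moment_even_pos:
  assumes "even e"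
  shows "sphere_moment \<mu> e > 0"
proof -
  obtain u where u: "u \<in> K" "norm u = 1" by (rule unit_vector_in_rotation_invariant)
  have int: "integrable \<mu> (\<lambda>x. (u \<bullet> x) ^ e)" for e
    by (intro integrable_rotation_invariant_continuous[OF inv] continuous_intros)
  have nn: "sphere_moment \<mu> e \<ge> 0"
    unfolding sphere_moment_eq[OF u] using assms by (intro Bochner_Integration.integral_nonneg) (simp add: zero_le_even_power)
  have False if "sphere_moment \<mu> e = 0"
  proof -
    have "e \<noteq> 0" using that sphere_moment_0 by (metis zero_neq_one)
    have "AE x in \<mu>. (u \<bullet> x) ^ e = 0"
      using that assms integral_nonneg_eq_0_iff_AE[OF int[of e]]
      by (simp add: sphere_moment_eq[OF u] zero_le_even_power)
    hence "AE x in \<mu>. (u \<bullet> x)\<^sup>2 = 0"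
      using \<open>e \<noteq> 0\<close> by simp
    hence "sphere_moment \<mu> 2 = 0"
      unfolding sphere_moment_eq[OF u] by (rule integral_eq_zero_AE)
    thus False using sphere_moment_2 by simp
  qed
  thus ?thesis using nn by fastforce
qed

end

subsection \<open>Random orthogonal pairs\<close>

text \<open>A Gram-Schmidt step for a unit vector \<open>y\<close>. Independent points
  \<open>y\<close> and \<open>z\<close> of the sphere thus give a model of a random orthogonal pair;
  leaving the second vector unnormalised avoids an exceptional null set.\<close>

definition orth_part :: "'a::real_inner \<Rightarrow> 'a \<Rightarrow> 'a" where
  "orth_part y z = z - (z \<bullet> y) *\<^sub>R y"

lemma orth_part_orthogonal: "norm y = 1 \<Longrightarrow> y \<bullet> orth_part y z = 0"
  by (simp add: orth_part_def inner_diff_right inner_commute norm_eq_1)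

lemma norm_orth_part_sq: "norm y = 1 \<Longrightarrow> (norm (orth_part y z))\<^sup>2 = (norm z)\<^sup>2 - (z \<bullet> y)\<^sup>2"
  unfolding power2_norm_eq_inner orth_part_def
  by (simp add: inner_diff_left inner_diff_right inner_commute norm_eq_1 power2_eq_square)

lemma norm_orth_part_le:
  assumes "norm y = 1"
  shows "norm (orth_part y z) \<le> norm z"
proof (rule power2_le_imp_le)
  show "(norm (orth_part y z))\<^sup>2 \<le> (norm z)\<^sup>2"
    unfolding norm_orth_part_sq[OF assms] by simp
qed simp

lemma orth_part_orthogonal_transformation:
  "orthogonal_transformation g \<Longrightarrow> orth_part (g y) (g z) = g (orth_part y z)"
  by (simp add: orth_part_def orthogonal_transformation_def linear_diff linear_scale)

lemma abs_inner_power_mult_le_1: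
  fixes U X :: "'a::real_inner"
  assumes "\<bar>U \<bullet> a\<bar> \<le> 1" "\<bar>X \<bullet> b\<bar> \<le> C"
  shows "\<bar>(U \<bullet> a) ^ i * (X \<bullet> b) ^ e\<bar> \<le> C ^ e"
proof -
  have "\<bar>(U \<bullet> a) ^ i * (X \<bullet> b) ^ e\<bar> = \<bar>U \<bullet> a\<bar> ^ i * \<bar>X \<bullet> b\<bar> ^ e"
    by (simp add: abs_mult power_abs)
  also have "\<dots> \<le> 1 * C ^ e"
    using assms by (intro mult_mono power_mono power_le_one) auto
  finally show ?thesis by simp
qed

context
  fixes \<sigma> :: "'a::euclidean_space measure"
  assumes inv: "rotation_invariant_on_sphere UNIV \<sigma>"
begin

interpretation sphere: prob_space \<sigma>
  by (rule rotation_invariant_prob_space[OF inv])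

interpretation sphere2: pair_prob_space \<sigma> \<sigma> ..

lemma measurable_sphere_ident: "(\<lambda>x. x) \<in> \<sigma> \<rightarrow>\<^sub>M borel"
  by (rule measurable_rotation_invariant[OF inv]) simp

lemma measurable_sphere_fst: "fst \<in> (\<sigma> \<Otimes>\<^sub>M N) \<rightarrow>\<^sub>M borel"
  using measurable_compose[OF measurable_fst measurable_sphere_ident] .

lemma measurable_sphere_snd: "snd \<in> (N \<Otimes>\<^sub>M \<sigma>) \<rightarrow>\<^sub>M borel"
  using measurable_compose[OF measurable_snd measurable_sphere_ident] .

lemma norm_sphere: "x \<in> space \<sigma> \<Longrightarrow> norm x = 1"
  by (simp add: space_rotation_invariant[OF inv])

lemma integral_pair_rotation_invariant:
  fixes f :: "'a \<times> 'a \<Rightarrow> real"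
  assumes g: "orthogonal_transformation g" and f: "f \<in> borel_measurable (\<sigma> \<Otimes>\<^sub>M \<sigma>)"
  shows "(\<integral>z. f (g (fst z), g (snd z)) \<partial>(\<sigma> \<Otimes>\<^sub>M \<sigma>)) = (\<integral>z. f z \<partial>(\<sigma> \<Otimes>\<^sub>M \<sigma>))"
proof -
  have im: "g ` UNIV = UNIV" using g by (simp add: orthogonal_transformation_surj)
  have "g \<in> borel \<rightarrow>\<^sub>M borel"
    using orthogonal_transformation_linear[OF g]
    by (intro borel_measurable_continuous_onI linear_continuous_on) (simp add: linear_conv_bounded_linear)
  hence "g \<in> restrict_space borel (sphere 0 1 \<inter> UNIV) \<rightarrow>\<^sub>M restrict_space borel (sphere 0 1 \<inter> UNIV)"
    using g by (intro measurable_restrict_space3)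
      (auto simp: orthogonal_transformation_norm)
  hence gm: "g \<in> \<sigma> \<rightarrow>\<^sub>M \<sigma>"
    by (simp only: measurable_cong_sets[OF sets_rotation_invariant[OF inv] sets_rotation_invariant[OF inv]])
  have d: "distr \<sigma> \<sigma> g = \<sigma>"
    using inv g im by (simp add: rotation_invariant_on_sphere_def)
  have "distr (\<sigma> \<Otimes>\<^sub>M \<sigma>) (\<sigma> \<Otimes>\<^sub>M \<sigma>) (\<lambda>(x, y). (g x, g y)) = \<sigma> \<Otimes>\<^sub>M \<sigma>"
    using pair_measure_distr[OF gm gm] sphere.sigma_finite_measure_axioms by (simp add: d)
  moreover have "(\<integral>z. f z \<partial>distr (\<sigma> \<Otimes>\<^sub>M \<sigma>) (\<sigma> \<Otimes>\<^sub>M \<sigma>) (\<lambda>(x, y). (g x, g y)))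
      = (\<integral>z. f ((\<lambda>(x, y). (g x, g y)) z) \<partial>(\<sigma> \<Otimes>\<^sub>M \<sigma>))"
    unfolding case_prod_beta
    by (intro integral_distr f measurable_Pair measurable_compose[OF measurable_fst gm]
        measurable_compose[OF measurable_snd gm])
  ultimately show ?thesis by (simp add: case_prod_beta)
qed

text \<open>
  Fubini against the pair \<open>(y, orth_part y z)\<close> turns the moments of an arbitrary invariant law of
  orthogonal pairs \<open>(X, U)\<close> into a constant that does not depend on that law, because
  the orthogonal group acts transitively on orthogonal pairs of prescribed lengths.
\<close>

lemma orthogonal_pair_moment:
  fixes X U :: "'w \<Rightarrow> 'a"
  assumes L: "prob_space L" and [measurable]: "X \<in> borel_measurable L" "U \<in> borel_measurable L"
    and XU: "\<And>\<omega>. \<omega> \<in> space L \<Longrightarrow> X \<omega> \<bullet> U \<omega> = 0"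
    and bnd: "\<And>\<omega>. \<omega> \<in> space L \<Longrightarrow> norm (X \<omega>) \<le> 1" "\<And>\<omega>. \<omega> \<in> space L \<Longrightarrow> norm (U \<omega>) \<le> 1"
    and invL: "\<And>g a b. orthogonal_transformation g \<Longrightarrow>
      (\<integral>\<omega>. (U \<omega> \<bullet> g a) ^ i * (X \<omega> \<bullet> g b) ^ e \<partial>L) = (\<integral>\<omega>. (U \<omega> \<bullet> a) ^ i * (X \<omega> \<bullet> b) ^ e \<partial>L)"
    and aw: "a \<bullet> w = 0" "norm a = 1" "norm w = 1"
  shows "(\<integral>\<omega>. (U \<omega> \<bullet> a) ^ i * (X \<omega> \<bullet> (\<beta> *\<^sub>R a + r *\<^sub>R w)) ^ e \<partial>L)
      * (\<integral>z. norm (orth_part (fst z) (snd z)) ^ e \<partial>(\<sigma> \<Otimes>\<^sub>M \<sigma>)) =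
    (\<integral>\<omega>. norm (X \<omega>) ^ e * norm (U \<omega>) ^ i \<partial>L)
      * (\<integral>z. (w \<bullet> fst z) ^ i * (a \<bullet> ((\<beta> * norm (orth_part (fst z) (snd z))) *\<^sub>R fst z
            + r *\<^sub>R orth_part (fst z) (snd z))) ^ e \<partial>(\<sigma> \<Otimes>\<^sub>M \<sigma>))"
    (is "?F * ?Z = ?A * ?\<kappa>")
proof -
  note [measurable] = measurable_sphere_ident measurable_sphere_fst measurable_sphere_snd
  interpret L: prob_space L by fact
  interpret PL: pair_prob_space "\<sigma> \<Otimes>\<^sub>M \<sigma>" L ..
  let ?S = "\<sigma> \<Otimes>\<^sub>M \<sigma>"
  let ?u = "\<lambda>z::'a\<times>'a. orth_part (fst z) (snd z)"
  \<comment> \<open>The image of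
    \<open>norm (?u z) *\<^sub>R (\<beta> *\<^sub>R a + r *\<^sub>R w)\<close> under an isometry
    taking \<open>a\<close> to \<open>fst z\<close> and \<open>norm (?u z) *\<^sub>R w\<close> to
    \<open>?u z\<close>. The stretching avoids a division by \<open>norm (?u z)\<close>.\<close>
  let ?b = "\<lambda>z. (\<beta> * norm (?u z)) *\<^sub>R fst z + r *\<^sub>R ?u z"
  let ?h = "\<lambda>z \<omega>. (U \<omega> \<bullet> fst z) ^ i * (X \<omega> \<bullet> ?b z) ^ e"
  have z: "norm (fst z) = 1" "norm (snd z) = 1" if "z \<in> space ?S" for z
    using that by (auto simp: space_pair_measure norm_sphere)
  have um [measurable]: "?u \<in> borel_measurable ?S"
    unfolding orth_part_def by measurable
  \<comment> \<open>For fixed \<open>z\<close>, invariance of the law of \<open>(X, U)\<close> moves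
    the test vectors back to \<open>a\<close> and \<open>w\<close>.\<close>
  have step1: "(\<integral>\<omega>. ?h z \<omega> \<partial>L) = norm (?u z) ^ e * ?F" if sp: "z \<in> space ?S" for z
  proof -
    obtain g where g: "orthogonal_transformation g" "g a = fst z" "g (norm (?u z) *\<^sub>R w) = ?u z"
      using orthogonal_transformation_between_pairs[of a "norm (?u z) *\<^sub>R w" "fst z" "?u z"]
        aw z[OF sp] orth_part_orthogonal[of "fst z" "snd z"] by auto
    have lin: "linear g" using g(1) by (rule orthogonal_transformation_linear)
    let ?c = "norm (?u z) *\<^sub>R (\<beta> *\<^sub>R a + r *\<^sub>R w)"
    have "g ?c = g ((\<beta> * norm (?u z)) *\<^sub>R a + r *\<^sub>R norm (?u z) *\<^sub>R w)"
      by (simp add: algebra_simps)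
    also have "\<dots> = ?b z"
      using g by (simp only: linear_add[OF lin] linear_scale[OF lin])
    finally have gc: "g ?c = ?b z" .
    have "(\<integral>\<omega>. ?h z \<omega> \<partial>L) = (\<integral>\<omega>. (U \<omega> \<bullet> g a) ^ i * (X \<omega> \<bullet> g ?c) ^ e \<partial>L)"
      by (simp only: gc g)
    also have "\<dots> = (\<integral>\<omega>. (U \<omega> \<bullet> a) ^ i * (X \<omega> \<bullet> ?c) ^ e \<partial>L)"
      by (rule invL[OF g(1)])
    also have "\<dots> = (\<integral>\<omega>. norm (?u z) ^ e * ((U \<omega> \<bullet> a) ^ i * (X \<omega> \<bullet> (\<beta> *\<^sub>R a + r *\<^sub>R w)) ^ e) \<partial>L)"
      by (simp add: power_mult_distrib mult_ac)
    finally show ?thesis by simp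
  qed
  \<comment> \<open>For fixed \<open>\<omega>\<close> it is the invariance of the product measure
    that rotates \<open>X \<omega>\<close> and \<open>U \<omega>\<close> to multiples of
    \<open>a\<close> and \<open>w\<close>; hence \<open>?\<kappa>\<close> does not involve
    \<open>L\<close>, \<open>X\<close> or \<open>U\<close>.\<close>
  have step2: "(\<integral>z. ?h z \<omega> \<partial>?S) = norm (X \<omega>) ^ e * norm (U \<omega>) ^ i * ?\<kappa>" if sp: "\<omega> \<in> space L" for \<omega>
  proof -
    obtain g where g: "orthogonal_transformation g" "g (norm (X \<omega>) *\<^sub>R a) = X \<omega>"
        "g (norm (U \<omega>) *\<^sub>R w) = U \<omega>"
      using orthogonal_transformation_between_pairs[of "norm (X \<omega>) *\<^sub>R a" "norm (U \<omega>) *\<^sub>R w" "X \<omega>" "U \<omega>"]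
        aw XU[OF sp] by auto
    have lin: "linear g" using g(1) by (rule orthogonal_transformation_linear)
    have inner: "g x \<bullet> g y = x \<bullet> y" for x y
      using g(1) by (simp add: orthogonal_transformation_def)
    have U: "U \<omega> \<bullet> g y = norm (U \<omega>) * (w \<bullet> y)" for y
      by (subst g(3)[symmetric]) (simp add: inner)
    have X: "X \<omega> \<bullet> g y = norm (X \<omega>) * (a \<bullet> y)" for y
      by (subst g(2)[symmetric]) (simp add: inner)
    have "?b (g (fst z), g (snd z)) = g (?b z)" for z
      by (simp add: orth_part_orthogonal_transformation[OF g(1)] orthogonal_transformation_norm[OF g(1)]
          linear_add[OF lin] linear_scale[OF lin])
    hence "?h (g (fst z), g (snd z)) \<omega> =
        norm (X \<omega>) ^ e * norm (U \<omega>) ^ i * ((w \<bullet> fst z) ^ i * (a \<bullet> ?b z) ^ e)" for z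
      by (simp only: U X fst_conv power_mult_distrib mult_ac)
    moreover have "(\<integral>z. ?h z \<omega> \<partial>?S) = (\<integral>z. ?h (g (fst z), g (snd z)) \<omega> \<partial>?S)"
      by (rule integral_pair_rotation_invariant[OF g(1), symmetric]) measurable
    ultimately show ?thesis by simp
  qed
  have "integrable (?S \<Otimes>\<^sub>M L) (\<lambda>(z, \<omega>). ?h z \<omega>)"
  proof (rule PL.integrable_const_bound[of _ "(\<bar>\<beta>\<bar> + \<bar>r\<bar>) ^ e"])
    show "AE p in ?S \<Otimes>\<^sub>M L. norm (case p of (z, \<omega>) \<Rightarrow> ?h z \<omega>) \<le> (\<bar>\<beta>\<bar> + \<bar>r\<bar>) ^ e"
    proof (rule AE_I2, safe)
      fix y y' \<omega> assume "((y, y'), \<omega>) \<in> space (?S \<Otimes>\<^sub>M L)"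
      hence S: "(y, y') \<in> space ?S" and om: "\<omega> \<in> space L"
        by (auto simp: space_pair_measure)
      let ?z = "(y, y')"
      have u1: "norm (?u ?z) \<le> 1" using norm_orth_part_le[of y y'] z[OF S] by simp
      have "norm (?b ?z) \<le> norm ((\<beta> * norm (?u ?z)) *\<^sub>R y) + norm (r *\<^sub>R ?u ?z)"
        using norm_triangle_ineq[of "(\<beta> * norm (?u ?z)) *\<^sub>R y" "r *\<^sub>R ?u ?z"] by simp
      also have "\<dots> = (\<bar>\<beta>\<bar> + \<bar>r\<bar>) * norm (?u ?z)"
        using z[OF S] by (simp add: abs_mult algebra_simps)
      also have "\<dots> \<le> \<bar>\<beta>\<bar> + \<bar>r\<bar>"
        using u1 mult_left_le[of "norm (?u ?z)" "\<bar>\<beta>\<bar> + \<bar>r\<bar>"] by simp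
      finally have b: "norm (?b ?z) \<le> \<bar>\<beta>\<bar> + \<bar>r\<bar>" .
      have "\<bar>U \<omega> \<bullet> y\<bar> \<le> 1"
        using Cauchy_Schwarz_ineq2[of "U \<omega>" y] bnd(2)[OF om] z[OF S] by simp
      moreover have "\<bar>X \<omega> \<bullet> ?b ?z\<bar> \<le> \<bar>\<beta>\<bar> + \<bar>r\<bar>"
      proof -
        have "\<bar>X \<omega> \<bullet> ?b ?z\<bar> \<le> norm (X \<omega>) * norm (?b ?z)" by (rule Cauchy_Schwarz_ineq2)
        also have "\<dots> \<le> 1 * (\<bar>\<beta>\<bar> + \<bar>r\<bar>)"
          by (intro mult_mono b bnd om) auto
        finally show ?thesis by simp
      qed
      ultimately show "norm (?h ?z \<omega>) \<le> (\<bar>\<beta>\<bar> + \<bar>r\<bar>) ^ e"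
        using abs_inner_power_mult_le_1 by simp
    qed
  qed measurable
  from PL.Fubini_integral[OF this]
  have "(\<integral>z. (\<integral>\<omega>. ?h z \<omega> \<partial>L) \<partial>?S) = (\<integral>\<omega>. (\<integral>z. ?h z \<omega> \<partial>?S) \<partial>L)" by simp
  also have "(\<integral>z. (\<integral>\<omega>. ?h z \<omega> \<partial>L) \<partial>?S) = ?Z * ?F"
    by (simp only: step1 cong: Bochner_Integration.integral_cong)
      (simp only: integral_mult_left_zero)
  also have "(\<integral>\<omega>. (\<integral>z. ?h z \<omega> \<partial>?S) \<partial>L) = ?A * ?\<kappa>"
    by (simp only: step2 cong: Bochner_Integration.integral_cong)
      (simp only: integral_mult_left_zero)
  finally show ?thesis by (simp only: mult.commute)
qed

text \<open>Otherwise \<open>orth_part\<close> would vanish almost everywhere, and the inner product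
  of two independent points would have second moment 1 instead of
  \<open>1 / DIM('a)\<close>.\<close>

lemma orth_part_moment_pos:
  assumes "even e" "2 \<le> DIM('a)"
  shows "(\<integral>z. norm (orth_part (fst z) (snd z)) ^ e \<partial>(\<sigma> \<Otimes>\<^sub>M \<sigma>)) > 0"
proof -
  note [measurable] = measurable_sphere_ident measurable_sphere_fst measurable_sphere_snd
  let ?S = "\<sigma> \<Otimes>\<^sub>M \<sigma>"
  let ?u = "\<lambda>z::'a\<times>'a. orth_part (fst z) (snd z)"
  have [measurable]: "?u \<in> borel_measurable ?S"
    unfolding orth_part_def by measurable
  have z: "norm (fst z) = 1" "norm (snd z) = 1" if "z \<in> space ?S" for z
    using that by (auto simp: space_pair_measure norm_sphere)
  have u1: "norm (?u z) \<le> 1" if "z \<in> space ?S" for z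
    using norm_orth_part_le[of "fst z" "snd z"] z[OF that] by simp
  have int: "integrable ?S (\<lambda>z. norm (?u z) ^ e)"
    using u1 by (intro sphere2.integrable_const_bound[of _ 1] AE_I2) (auto intro: power_le_one)
  have nn: "(\<integral>z. norm (?u z) ^ e \<partial>?S) \<ge> 0"
    by (intro Bochner_Integration.integral_nonneg) simp
  moreover have False if "(\<integral>z. norm (?u z) ^ e \<partial>?S) = 0"
  proof -
    have "AE z in ?S. norm (?u z) ^ e = 0"
      using that integral_nonneg_eq_0_iff_AE[OF int] by simp
    hence "AE z in ?S. ?u z = 0" by (auto elim!: eventually_mono)
    hence "AE z in ?S. (snd z \<bullet> fst z)\<^sup>2 = 1"
      using AE_space
    proof eventually_elim
      case (elim x)
      thus ?case using norm_orth_part_sq[of "fst x" "snd x"] z[of x] by simp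
    qed
    hence "(\<integral>z. (snd z \<bullet> fst z)\<^sup>2 \<partial>?S) = (\<integral>z. 1 \<partial>?S)"
      by (intro integral_cong_AE) auto
    also have "\<dots> = 1" by (simp add: sphere2.prob_space)
    finally have "(\<integral>z. (snd z \<bullet> fst z)\<^sup>2 \<partial>?S) = 1" .
    moreover have "(\<integral>z. (snd z \<bullet> fst z)\<^sup>2 \<partial>?S) = (\<integral>y. (\<integral>x. (x \<bullet> y)\<^sup>2 \<partial>\<sigma>) \<partial>\<sigma>)"
    proof (subst sphere2.integral_fst'[symmetric])
      have "(x \<bullet> y)\<^sup>2 \<le> 1" if "norm x = 1" "norm y = 1" for x y :: 'a
        using Cauchy_Schwarz_ineq2[of x y] that by (simp add: abs_square_le_1)
      thus "integrable ?S (\<lambda>z. (snd z \<bullet> fst z)\<^sup>2)"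
        using z by (intro sphere2.integrable_const_bound[of _ 1] AE_I2) auto
    qed simp
    moreover have "\<dots> = sphere_moment \<sigma> 2"
      by (simp add: sphere_moment_def inner_commute)
    ultimately show False
      using sphere_moment_2[OF subspace_UNIV inv] assms(2) by simp
  qed
  ultimately show ?thesis by (metis order_le_less)
qed

end

subsection \<open>Moments of random sections\<close>

text \<open>\<open>w\<close> is the normalised component of \<open>b\<close> orthogonal to
  \<open>a\<close>. If \<open>b\<close> is parallel to \<open>a\<close>, any unit vector orthogonal
  to \<open>a\<close> serves, and dimension at least 2 provides one.\<close>

lemma orth_complement_unit_vector:
  fixes a b :: "'a::euclidean_space"
  assumes "norm a = 1" "2 \<le> DIM('a)"
  obtains \<beta> r w where "a \<bullet> w = 0" "norm w = 1" "b = \<beta> *\<^sub>R a + r *\<^sub>R w"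
proof -
  let ?v = "orth_part a b"
  have b: "b = (b \<bullet> a) *\<^sub>R a + ?v" by (simp add: orth_part_def)
  show ?thesis
  proof (cases "?v = 0")
    case True
    obtain u where u: "u \<noteq> 0" "orthogonal a u"
      using orthogonal_to_vector_exists[OF assms(2)] by metis
    have "b = (b \<bullet> a) *\<^sub>R a + 0 *\<^sub>R (u /\<^sub>R norm u)" using b True by simp
    thus ?thesis
      using u by (intro that[where w = "u /\<^sub>R norm u" and \<beta> = "b \<bullet> a" and r = 0]) (auto simp: orthogonal_def)
  next
    case False
    have "b = (b \<bullet> a) *\<^sub>R a + norm ?v *\<^sub>R (?v /\<^sub>R norm ?v)" using b False by simp
    thus ?thesis
      using False orth_part_orthogonal[OF assms(1), of b]
      by (intro that[where w = "?v /\<^sub>R norm ?v" and \<beta> = "b \<bullet> a" and r = "norm ?v"]) auto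
  qed
qed

section \<open>Measurability and the orthogonal group on the Grassmannian\<close>

lemma space_grassmannian_borel: "space (grassmannian_borel k) = grassmannian k"
  by (simp add: grassmannian_borel_def)

lemma orth_proj_measurable [measurable]: "orth_proj \<in> borel_measurable (grassmannian_borel k)"
  unfolding grassmannian_borel_def by (rule measurable_vimage_algebra1) simp

lemma closest_point_measurable:
  "(\<lambda>K. closest_point K x) \<in> borel_measurable (grassmannian_borel k)"
proof -
  have "(\<lambda>A. blinfun_apply A x) \<in> borel_measurable borel"
    by (intro borel_measurable_continuous_onI continuous_intros)
  from measurable_compose[OF orth_proj_measurable this]
  have "(\<lambda>K. blinfun_apply (orth_proj K) x) \<in> borel_measurable (grassmannian_borel k)" .
  also have "?this \<longleftrightarrow> ?thesis"
    by (intro measurable_cong) (auto simp: space_grassmannian_borel grassmannian_def orth_proj_apply)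
  finally show ?thesis .
qed

lemma grassmannian_orthogonal_image:
  fixes g :: "'a::euclidean_space \<Rightarrow> 'a"
  assumes "orthogonal_transformation g" "K \<in> grassmannian k"
  shows "g ` K \<in> grassmannian k"
  using assms dim_image_eq[of g K] orthogonal_transformation_inj[of g]
  by (auto simp: grassmannian_def orthogonal_transformation_linear linear_subspace_image
      intro: inj_on_subset)

text \<open>On projections \<open>g\<close> acts by conjugation, which is continuous in the operator
  norm, and the sigma-algebra is generated by \<open>orth_proj\<close>.\<close>

lemma image_measurable_grassmannian:
  fixes g :: "'a::euclidean_space \<Rightarrow> 'a"
  assumes g: "orthogonal_transformation g"
  shows "(\<lambda>K. g ` K) \<in> grassmannian_borel k \<rightarrow>\<^sub>M grassmannian_borel k"
proof -
  have bl: "bounded_linear g" "bounded_linear (inv g)"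
    using g orthogonal_transformation_inv[OF g]
    by (simp_all add: orthogonal_transformation_linear linear_conv_bounded_linear[symmetric])
  define \<Phi> where "\<Phi> A = Blinfun g o\<^sub>L A o\<^sub>L Blinfun (inv g)" for A :: "'a \<Rightarrow>\<^sub>L 'a"
  have "\<Phi> \<in> borel_measurable borel"
    unfolding \<Phi>_def by (intro borel_measurable_continuous_onI continuous_intros)
  from measurable_compose[OF orth_proj_measurable this]
  have *: "(\<lambda>K. \<Phi> (orth_proj K)) \<in> borel_measurable (grassmannian_borel k)" .
  have eq: "\<Phi> (orth_proj K) = orth_proj (g ` K)" if "K \<in> grassmannian k" for K
  proof (rule blinfun_eqI)
    fix x
    have K: "subspace K" "subspace (g ` K)"
      using that grassmannian_orthogonal_image[OF g that] by (auto simp: grassmannian_def)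
    have "g (inv g x) = x"
      using g by (simp add: orthogonal_transformation_surj surj_f_inv_f)
    thus "blinfun_apply (\<Phi> (orth_proj K)) x = blinfun_apply (orth_proj (g ` K)) x"
      using closest_point_orthogonal_image[OF K(1) g, of "inv g x"]
      by (simp add: \<Phi>_def orth_proj_apply K bounded_linear_Blinfun_apply bl)
  qed
  have "(\<lambda>K. orth_proj (g ` K)) \<in> borel_measurable (grassmannian_borel k)"
    using * by (subst measurable_cong[where g="\<lambda>K. \<Phi> (orth_proj K)"])
      (simp_all add: eq space_grassmannian_borel)
  thus ?thesis
    unfolding grassmannian_borel_def[of k]
    by (intro measurable_vimage_algebra2)
      (auto simp: grassmannian_orthogonal_image[OF g])
qed

text \<open>Eliminates the unknown factor \<open>\<kappa>\<close> from two instances of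
  \<open>orthogonal_pair_moment\<close> with the same test vectors. Only \<open>c\<close> is
  cancelled, so \<open>\<kappa>\<close> may vanish.\<close>

lemma cross_ratio_eq:
  fixes a b c d :: real
  assumes "a * c = p * \<kappa>" "b * c = q * \<kappa>" "c > 0"
  shows "a * q = p * b"
proof -
  have "a * q * c = q * (a * c)" by simp
  also have "\<dots> = p * (b * c)" unfolding assms by simp
  finally have "a * q * c = p * b * c" by simp
  thus ?thesis using assms(3) by simp
qed

text \<open>The section measures are constrained one subspace at a time, and no measurable
  dependence on the subspace is assumed; measurability of section means is derived.\<close>

locale random_section =
  fixes k :: nat and \<sigma> :: "'a::euclidean_space measure" and \<sigma>\<^sub>H :: "'a set \<Rightarrow> 'a measure"
    and M :: "'w measure" and H :: "'w \<Rightarrow> 'a set"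
  assumes sphere: "rotation_invariant_on_sphere UNIV \<sigma>"
    and section_inv: "\<And>K. K \<in> grassmannian k \<Longrightarrow> rotation_invariant_on_sphere K (\<sigma>\<^sub>H K)"
    and k: "1 \<le> k" "k < DIM('a)"
    and M: "prob_space M"
    and random: "random_subspace M k H"
begin

sublocale prob_space M by (rule M)

sublocale sphere: prob_space \<sigma>
  by (rule rotation_invariant_prob_space[OF sphere])

sublocale sphere2: pair_prob_space \<sigma> \<sigma> ..

sublocale PM: pair_prob_space M "\<sigma> \<Otimes>\<^sub>M \<sigma>" ..

declare measurable_sphere_ident[OF sphere, measurable]
declare measurable_sphere_fst[OF sphere, measurable]
declare measurable_sphere_snd[OF sphere, measurable]

lemma norm_sphere2: "z \<in> space (\<sigma> \<Otimes>\<^sub>M \<sigma>) \<Longrightarrow> norm (fst z) = 1 \<and> norm (snd z) = 1"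
  by (auto simp: space_pair_measure norm_sphere[OF sphere])

lemma H_measurable [measurable]: "H \<in> M \<rightarrow>\<^sub>M grassmannian_borel k"
  using random by (simp add: random_subspace_def)

lemma H_grassmannian: "\<omega> \<in> space M \<Longrightarrow> H \<omega> \<in> grassmannian k"
  using measurable_space[OF H_measurable] by (simp add: space_grassmannian_borel)

lemma H_subspace: "\<omega> \<in> space M \<Longrightarrow> subspace (H \<omega>)"
  using H_grassmannian by (simp add: grassmannian_def)

lemma proj_measurable [measurable]: "(\<lambda>\<omega>. closest_point (H \<omega>) x) \<in> borel_measurable M"
  by (rule measurable_compose[OF H_measurable closest_point_measurable])

lemma random_subspace_invariant:
  fixes \<Phi> :: "'a set \<Rightarrow> real"
  assumes g: "orthogonal_transformation g" and [measurable]: "\<Phi> \<in> borel_measurable (grassmannian_borel k)"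
  shows "expectation (\<lambda>\<omega>. \<Phi> (g ` H \<omega>)) = expectation (\<lambda>\<omega>. \<Phi> (H \<omega>))"
proof -
  note [measurable] = image_measurable_grassmannian[OF g]
  let ?G = "grassmannian_borel k" let ?\<nu> = "distr M ?G H"
  have "distr ?\<nu> ?\<nu> (\<lambda>K. g ` K) = ?\<nu>"
    using random g by (simp add: random_subspace_def rotation_invariant_on_grassmannian_def)
  hence "(\<integral>K. \<Phi> K \<partial>?\<nu>) = (\<integral>K. \<Phi> K \<partial>distr ?\<nu> ?\<nu> (\<lambda>K. g ` K))" by simp
  also have "\<dots> = (\<integral>K. \<Phi> (g ` K) \<partial>?\<nu>)"
    by (intro integral_distr) measurable
  finally show ?thesis
    by (simp add: integral_distr)
qed

text \<open>An isometry carrying \<open>K\<close> to \<open>K'\<close> intertwines the two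
  projections and preserves the law of \<open>y\<close>.\<close>

lemma proj_moment_const:
  assumes "K \<in> grassmannian k" "K' \<in> grassmannian k"
  shows "(\<integral>y. norm (closest_point K y) ^ e \<partial>\<sigma>) = (\<integral>y. norm (closest_point K' y) ^ e \<partial>\<sigma>)"
    and "(\<integral>y. norm (y - closest_point K y) ^ e \<partial>\<sigma>) = (\<integral>y. norm (y - closest_point K' y) ^ e \<partial>\<sigma>)"
proof -
  have K: "subspace K" "subspace K'" "dim K = dim K'"
    using assms by (auto simp: grassmannian_def)
  obtain g where g: "orthogonal_transformation g" "g ` K = K'"
    by (rule orthogonal_transformation_between_subspaces[OF K])
  have lin: "linear g" using g(1) by (rule orthogonal_transformation_linear)
  have cl: "closest_point K' (g y) = g (closest_point K y)" for y
    using closest_point_orthogonal_image[OF K(1) g(1)] g(2) by simp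
  have [measurable]: "closest_point K' \<in> borel_measurable borel"
    using linear_closest_point_subspace[OF K(2)]
    by (intro borel_measurable_continuous_onI linear_continuous_on) (simp add: linear_conv_bounded_linear)
  have im: "g ` UNIV = UNIV" using g by (simp add: orthogonal_transformation_surj)
  have "(\<integral>y. norm (closest_point K' y) ^ e \<partial>\<sigma>) = (\<integral>y. norm (closest_point K' (g y)) ^ e \<partial>\<sigma>)"
    by (rule integral_rotation_invariant[OF sphere g(1) im, symmetric]) measurable
  thus "(\<integral>y. norm (closest_point K y) ^ e \<partial>\<sigma>) = (\<integral>y. norm (closest_point K' y) ^ e \<partial>\<sigma>)"
    by (simp add: cl orthogonal_transformation_norm[OF g(1)])
  have "(\<integral>y. norm (y - closest_point K' y) ^ e \<partial>\<sigma>) = (\<integral>y. norm (g y - closest_point K' (g y)) ^ e \<partial>\<sigma>)"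
    by (rule integral_rotation_invariant[OF sphere g(1) im, symmetric]) measurable
  thus "(\<integral>y. norm (y - closest_point K y) ^ e \<partial>\<sigma>) = (\<integral>y. norm (y - closest_point K' y) ^ e \<partial>\<sigma>)"
    by (simp add: cl orthogonal_transformation_norm[OF g(1)] linear_diff[OF lin, symmetric])
qed

text \<open>The moments defined from it depend only on \<open>k\<close>, so they are evaluated at
  one arbitrary subspace. The choice succeeds because the space of \<open>M\<close> is
  nonempty.\<close>

definition "reference_subspace = (SOME K. K \<in> (grassmannian k :: 'a set set))"

lemma reference_subspace: "reference_subspace \<in> grassmannian k"
  using H_grassmannian not_empty unfolding reference_subspace_def by (metis ex_in_conv someI)

definition "section_moment e = sphere_moment (\<sigma>\<^sub>H reference_subspace) e"
definition "proj_moment e = (\<integral>y. norm (closest_point reference_subspace y) ^ e \<partial>\<sigma>)"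
definition "coproj_moment e = (\<integral>y. norm (y - closest_point reference_subspace y) ^ e \<partial>\<sigma>)"
definition "orth_moment e = (\<integral>z. norm (orth_part (fst z) (snd z)) ^ e \<partial>(\<sigma> \<Otimes>\<^sub>M \<sigma>))"

text \<open>Fubini for \<open>(y \<bullet> x) ^ e\<close> with \<open>y\<close> on the full sphere
  and \<open>x\<close> on the section: integrating over \<open>y\<close> first gives a constant,
  integrating over \<open>x\<close> first gives a power of the projection of
  \<open>y\<close>.\<close>

lemma sphere_moment_factor:
  assumes "K \<in> grassmannian k"
  shows "sphere_moment (\<sigma>\<^sub>H K) e * (\<integral>y. norm (closest_point K y) ^ e \<partial>\<sigma>) = sphere_moment \<sigma> e"
proof -
  note inv = section_inv[OF assms]
  have K: "subspace K" using assms by (simp add: grassmannian_def)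
  interpret S: prob_space "\<sigma>\<^sub>H K" by (rule rotation_invariant_prob_space[OF inv])
  interpret P: pair_prob_space \<sigma> "\<sigma>\<^sub>H K" ..
  have m [measurable]: "(\<lambda>x. x) \<in> \<sigma>\<^sub>H K \<rightarrow>\<^sub>M borel"
    by (rule measurable_rotation_invariant[OF inv]) simp
  have [measurable]: "snd \<in> (N \<Otimes>\<^sub>M \<sigma>\<^sub>H K) \<rightarrow>\<^sub>M borel" for N :: "'a measure"
    using measurable_compose[OF measurable_snd m] .
  have "integrable (\<sigma> \<Otimes>\<^sub>M \<sigma>\<^sub>H K) (\<lambda>(y, x). (y \<bullet> x) ^ e)"
  proof (rule P.integrable_const_bound[of _ 1])
    show "AE z in \<sigma> \<Otimes>\<^sub>M \<sigma>\<^sub>H K. norm (case z of (y, x) \<Rightarrow> (y \<bullet> x) ^ e) \<le> 1"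
    proof (rule AE_I2, safe)
      fix y x assume "(y, x) \<in> space (\<sigma> \<Otimes>\<^sub>M \<sigma>\<^sub>H K)"
      hence "norm y = 1" "norm x = 1"
        by (auto simp: space_pair_measure space_rotation_invariant[OF inv] norm_sphere[OF sphere])
      hence "\<bar>y \<bullet> x\<bar> \<le> 1" using Cauchy_Schwarz_ineq2[of y x] by simp
      thus "norm ((y \<bullet> x) ^ e) \<le> 1" by (simp add: power_abs power_le_one)
    qed
  qed measurable
  from P.Fubini_integral[OF this]
  have "(\<integral>x. (\<integral>y. (y \<bullet> x) ^ e \<partial>\<sigma>) \<partial>\<sigma>\<^sub>H K) = (\<integral>y. (\<integral>x. (y \<bullet> x) ^ e \<partial>\<sigma>\<^sub>H K) \<partial>\<sigma>)" by simp
  also have "\<dots> = sphere_moment (\<sigma>\<^sub>H K) e * (\<integral>y. norm (closest_point K y) ^ e \<partial>\<sigma>)"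
    by (simp add: integral_inner_power[OF K inv])
  also have "(\<integral>x. (\<integral>y. (y \<bullet> x) ^ e \<partial>\<sigma>) \<partial>\<sigma>\<^sub>H K) = (\<integral>x. sphere_moment \<sigma> e \<partial>\<sigma>\<^sub>H K)"
    using integral_inner_power[OF subspace_UNIV sphere, where e = e]
    by (intro Bochner_Integration.integral_cong)
      (auto simp: space_rotation_invariant[OF inv] inner_commute closest_point_self)
  finally show ?thesis by (simp add: S.prob_space)
qed

lemma section_moment_proj_moment: "section_moment e * proj_moment e = sphere_moment \<sigma> e"
  unfolding section_moment_def proj_moment_def by (rule sphere_moment_factor[OF reference_subspace])

text \<open>The invariant measures on different subspaces are not compared directly. For even
  \<open>e\<close>, \<open>sphere_moment_factor\<close> fixes the moment as a quotient of quantities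
  independent of \<open>K\<close>; for odd \<open>e\<close> it vanishes.\<close>

lemma section_moment_eq:
  assumes "K \<in> grassmannian k"
  shows "sphere_moment (\<sigma>\<^sub>H K) e = section_moment e"
proof (cases "even e")
  case True
  have "sphere_moment (\<sigma>\<^sub>H K) e * proj_moment e = section_moment e * proj_moment e"
    using sphere_moment_factor[OF assms, of e] section_moment_proj_moment[of e]
      proj_moment_const(1)[OF assms reference_subspace, of e]
    by (simp add: proj_moment_def)
  moreover have "proj_moment e \<noteq> 0"
    using section_moment_proj_moment[of e] sphere_moment_even_pos[OF subspace_UNIV sphere True] by auto
  ultimately show ?thesis by simp
next
  case False
  thus ?thesis
    using sphere_moment_odd[OF _ section_inv[OF assms]] sphere_moment_odd[OF _ section_inv[OF reference_subspace]]
      assms reference_subspace by (simp add: section_moment_def grassmannian_def)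
qed

definition section_mean :: "('a \<Rightarrow> real) \<Rightarrow> 'w \<Rightarrow> real" where
  "section_mean f \<omega> = (\<integral>x. f x \<partial>\<sigma>\<^sub>H (H \<omega>))"

lemma section_mean_inner_power:
  "\<omega> \<in> space M \<Longrightarrow>
    section_mean (\<lambda>x. (b \<bullet> x) ^ e) \<omega> = section_moment e * norm (closest_point (H \<omega>) b) ^ e"
  using integral_inner_power[OF H_subspace section_inv[OF H_grassmannian]]
    section_moment_eq[OF H_grassmannian] by (simp add: section_mean_def)

text \<open>Expanding \<open>v x\<close> in a basis reduces joint measurability in subspace and
  vector to the projections of finitely many fixed vectors.\<close>

lemma proj_pair_measurable:
  assumes f: "f \<in> N \<rightarrow>\<^sub>M M" and v: "v \<in> borel_measurable N"
  shows "(\<lambda>x. closest_point (H (f x)) (v x)) \<in> borel_measurable N"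
proof -
  note [measurable] = f v
  have "(\<lambda>x. \<Sum>b\<in>Basis. (v x \<bullet> b) *\<^sub>R closest_point (H (f x)) b) \<in> borel_measurable N"
    by (intro borel_measurable_sum borel_measurable_scaleR measurable_compose[OF f proj_measurable]) measurable
  also have "?this \<longleftrightarrow> ?thesis"
  proof (intro measurable_cong)
    fix x assume "x \<in> space N"
    hence "subspace (H (f x))" using H_subspace measurable_space[OF f] by blast
    hence "linear (closest_point (H (f x)))" by (rule linear_closest_point_subspace)
    hence "closest_point (H (f x)) (\<Sum>b\<in>Basis. (v x \<bullet> b) *\<^sub>R b)
        = (\<Sum>b\<in>Basis. (v x \<bullet> b) *\<^sub>R closest_point (H (f x)) b)"
      by (simp add: linear_sum linear_scale)
    thus "(\<Sum>b\<in>Basis. (v x \<bullet> b) *\<^sub>R closest_point (H (f x)) b) = closest_point (H (f x)) (v x)"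
      by (simp add: euclidean_representation)
  qed
  finally show ?thesis .
qed

end

lemma abs_inner_power_le: "\<bar>(p \<bullet> x) ^ e\<bar> \<le> norm p ^ e" if "norm x \<le> 1" for p x :: "'a::real_inner"
proof -
  have "\<bar>p \<bullet> x\<bar> \<le> norm p"
    using Cauchy_Schwarz_ineq2[of p x] mult_left_le[OF that, of "norm p"] by simp
  thus ?thesis by (simp add: power_abs power_mono)
qed

section \<open>The transfer identity between random sections and the sphere\<close>

context random_section
begin

lemma sphere2_inner_power:
  "(\<integral>z. (q \<bullet> snd z) ^ i * (p \<bullet> fst z) ^ e \<partial>(\<sigma> \<Otimes>\<^sub>M \<sigma>)) =
    sphere_moment \<sigma> i * norm q ^ i * (sphere_moment \<sigma> e * norm p ^ e)"
proof -
  have "(\<integral>z. (q \<bullet> snd z) ^ i * (p \<bullet> fst z) ^ e \<partial>(\<sigma> \<Otimes>\<^sub>M \<sigma>)) =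
      (\<integral>y. (\<integral>y'. (q \<bullet> y') ^ i * (p \<bullet> y) ^ e \<partial>\<sigma>) \<partial>\<sigma>)"
  proof (subst sphere2.integral_fst'[symmetric])
    show "integrable (\<sigma> \<Otimes>\<^sub>M \<sigma>) (\<lambda>z. (q \<bullet> snd z) ^ i * (p \<bullet> fst z) ^ e)"
    proof (rule sphere2.integrable_const_bound[of _ "norm q ^ i * norm p ^ e"])
      show "AE z in \<sigma> \<Otimes>\<^sub>M \<sigma>. norm ((q \<bullet> snd z) ^ i * (p \<bullet> fst z) ^ e) \<le> norm q ^ i * norm p ^ e"
      proof (rule AE_I2)
        fix z assume "z \<in> space (\<sigma> \<Otimes>\<^sub>M \<sigma>)"
        thus "norm ((q \<bullet> snd z) ^ i * (p \<bullet> fst z) ^ e) \<le> norm q ^ i * norm p ^ e"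
          using norm_sphere2[of z] unfolding real_norm_def abs_mult
          by (intro mult_mono abs_inner_power_le) auto
      qed
    qed measurable
  qed simp
  also have "\<dots> = (\<integral>y. sphere_moment \<sigma> i * norm q ^ i * (p \<bullet> y) ^ e \<partial>\<sigma>)"
    using integral_inner_power[OF subspace_UNIV sphere] by (simp add: closest_point_self)
  also have "\<dots> = sphere_moment \<sigma> i * norm q ^ i * (sphere_moment \<sigma> e * norm p ^ e)"
    using integral_inner_power[OF subspace_UNIV sphere] by (simp add: closest_point_self)
  finally show ?thesis .
qed

text \<open>With \<open>P\<close> the projection onto the random subspace, auxiliary independent
  points \<open>y\<close> and \<open>y'\<close> of the sphere turn the lengths of
  \<open>a - P a\<close> and \<open>P b\<close> into mixed moments of \<open>P y\<close> and
  \<open>y' - P y'\<close>, by self-adjointness of \<open>P\<close>. These vectors are orthogonal,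
  so \<open>orthogonal_pair_moment\<close> applies to them.\<close>

lemma section_pair_inner_power:
  "(\<integral>p. ((snd (snd p) - closest_point (H (fst p)) (snd (snd p))) \<bullet> a) ^ i
        * (closest_point (H (fst p)) (fst (snd p)) \<bullet> b) ^ e \<partial>(M \<Otimes>\<^sub>M (\<sigma> \<Otimes>\<^sub>M \<sigma>))) =
    sphere_moment \<sigma> i * sphere_moment \<sigma> e *
      expectation (\<lambda>\<omega>. norm (a - closest_point (H \<omega>) a) ^ i * norm (closest_point (H \<omega>) b) ^ e)"
proof -
  let ?f = "\<lambda>p. ((snd (snd p) - closest_point (H (fst p)) (snd (snd p))) \<bullet> a) ^ i
        * (closest_point (H (fst p)) (fst (snd p)) \<bullet> b) ^ e"
  let ?L = "M \<Otimes>\<^sub>M (\<sigma> \<Otimes>\<^sub>M \<sigma>)"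
  have [measurable]: "(\<lambda>p. closest_point (H (fst p)) (fst (snd p))) \<in> borel_measurable ?L"
    "(\<lambda>p. closest_point (H (fst p)) (snd (snd p))) \<in> borel_measurable ?L"
    by (intro proj_pair_measurable; measurable)+
  have eq: "?f (\<omega>, z) = ((a - closest_point (H \<omega>) a) \<bullet> snd z) ^ i * (closest_point (H \<omega>) b \<bullet> fst z) ^ e"
    if "\<omega> \<in> space M" for \<omega> z
    using closest_point_subspace_inner(2)[OF H_subspace[OF that]]
    by (simp add: inner_diff_left inner_diff_right inner_commute)
  have "integrable ?L ?f"
  proof (rule PM.integrable_const_bound[of _ "norm a ^ i * norm b ^ e"])
    show "AE p in ?L. norm (?f p) \<le> norm a ^ i * norm b ^ e"
    proof (rule AE_I2, safe)
      fix \<omega> y y' assume "(\<omega>, (y, y')) \<in> space ?L"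
      hence om: "\<omega> \<in> space M" and y: "norm y = 1" "norm y' = 1"
        using norm_sphere2[of "(y, y')"] by (auto simp: space_pair_measure)
      note P = closest_point_subspace_inner[OF H_subspace[OF om]]
      have "(norm (a - closest_point (H \<omega>) a))\<^sup>2 \<le> (norm a)\<^sup>2"
        unfolding P(4) by simp
      hence na: "norm (a - closest_point (H \<omega>) a) \<le> norm a"
        by (rule power2_le_imp_le) simp
      have "\<bar>((a - closest_point (H \<omega>) a) \<bullet> y') ^ i\<bar> \<le> norm a ^ i"
        using abs_inner_power_le[OF eq_refl[OF y(2)], of "a - closest_point (H \<omega>) a" i]
          power_mono[OF na norm_ge_zero, of i] by linarith
      moreover have "\<bar>(closest_point (H \<omega>) b \<bullet> y) ^ e\<bar> \<le> norm b ^ e"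
        using abs_inner_power_le[OF eq_refl[OF y(1)], of "closest_point (H \<omega>) b" e]
          power_mono[OF P(5)[of b] norm_ge_zero, of e] by linarith
      ultimately show "norm (?f (\<omega>, (y, y'))) \<le> norm a ^ i * norm b ^ e"
        unfolding eq[OF om] unfolding real_norm_def abs_mult snd_conv fst_conv
        by (intro mult_mono) auto
    qed
  qed measurable
  hence "(\<integral>p. ?f p \<partial>?L) = (\<integral>\<omega>. (\<integral>z. ?f (\<omega>, z) \<partial>(\<sigma> \<Otimes>\<^sub>M \<sigma>)) \<partial>M)"
    by (rule PM.integral_fst'[symmetric])
  also have "\<dots> = (\<integral>\<omega>. sphere_moment \<sigma> i * sphere_moment \<sigma> e *
      (norm (a - closest_point (H \<omega>) a) ^ i * norm (closest_point (H \<omega>) b) ^ e) \<partial>M)"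
    by (intro Bochner_Integration.integral_cong refl)
      (simp only: eq sphere2_inner_power, simp only: mult_ac)
  finally show ?thesis by simp
qed

text \<open>Moving \<open>g\<close> from the vectors to the subspace leaves the lengths unchanged.
  This supplies the invariance that \<open>orthogonal_pair_moment\<close> asks for.\<close>

lemma section_pair_invariant:
  assumes g: "orthogonal_transformation g"
  shows "expectation (\<lambda>\<omega>. norm (g a - closest_point (H \<omega>) (g a)) ^ i * norm (closest_point (H \<omega>) (g b)) ^ e)
    = expectation (\<lambda>\<omega>. norm (a - closest_point (H \<omega>) a) ^ i * norm (closest_point (H \<omega>) b) ^ e)"
proof -
  note [measurable] = closest_point_measurable
  let ?\<Phi> = "\<lambda>K. norm (g a - closest_point K (g a)) ^ i * norm (closest_point K (g b)) ^ e"
  have "?\<Phi> (g ` H \<omega>) = norm (a - closest_point (H \<omega>) a) ^ i * norm (closest_point (H \<omega>) b) ^ e"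
    if "\<omega> \<in> space M" for \<omega>
    using closest_point_orthogonal_image[OF H_subspace[OF that] g] orthogonal_transformation_norm[OF g]
      linear_diff[OF orthogonal_transformation_linear[OF g], symmetric] by simp
  hence "expectation (\<lambda>\<omega>. norm (a - closest_point (H \<omega>) a) ^ i * norm (closest_point (H \<omega>) b) ^ e)
      = expectation (\<lambda>\<omega>. ?\<Phi> (g ` H \<omega>))"
    by (intro Bochner_Integration.integral_cong) simp_all
  also have "\<dots> = expectation (\<lambda>\<omega>. ?\<Phi> (H \<omega>))"
    by (rule random_subspace_invariant[OF g]) measurable
  finally show ?thesis by simp
qed

text \<open>The counterpart of \<open>section_pair_inner_power\<close> for the model pair; the
  linear map \<open>orth_part y\<close> is symmetric as well.\<close>

lemma sphere_pair_inner_power: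
  "(\<integral>z. (orth_part (fst z) (snd z) \<bullet> a) ^ i * (fst z \<bullet> b) ^ e \<partial>(\<sigma> \<Otimes>\<^sub>M \<sigma>)) =
    sphere_moment \<sigma> i * (\<integral>y. norm (orth_part y a) ^ i * (b \<bullet> y) ^ e \<partial>\<sigma>)"
proof -
  let ?f = "\<lambda>z. (orth_part (fst z) (snd z) \<bullet> a) ^ i * (fst z \<bullet> b) ^ e"
  have [measurable]: "(\<lambda>z. orth_part (fst z) (snd z)) \<in> borel_measurable (\<sigma> \<Otimes>\<^sub>M \<sigma>)"
    unfolding orth_part_def by measurable
  have "integrable (\<sigma> \<Otimes>\<^sub>M \<sigma>) ?f"
  proof (rule sphere2.integrable_const_bound[of _ "norm a ^ i * norm b ^ e"])
    show "AE z in \<sigma> \<Otimes>\<^sub>M \<sigma>. norm (?f z) \<le> norm a ^ i * norm b ^ e"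
    proof (rule AE_I2)
      fix z assume z: "z \<in> space (\<sigma> \<Otimes>\<^sub>M \<sigma>)"
      have "norm (orth_part (fst z) (snd z)) \<le> 1"
        using norm_sphere2[OF z] norm_orth_part_le[of "fst z" "snd z"] by simp
      thus "norm (?f z) \<le> norm a ^ i * norm b ^ e"
        using norm_sphere2[OF z] unfolding real_norm_def abs_mult inner_commute[of _ a] inner_commute[of _ b]
        by (intro mult_mono abs_inner_power_le) auto
    qed
  qed measurable
  hence "(\<integral>z. ?f z \<partial>(\<sigma> \<Otimes>\<^sub>M \<sigma>)) = (\<integral>y. (\<integral>y'. ?f (y, y') \<partial>\<sigma>) \<partial>\<sigma>)"
    by (rule sphere2.integral_fst'[symmetric])
  also have "\<dots> = (\<integral>y. (\<integral>y'. (orth_part y a \<bullet> y') ^ i * (b \<bullet> y) ^ e \<partial>\<sigma>) \<partial>\<sigma>)"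
    by (simp add: orth_part_def inner_diff_left inner_diff_right inner_commute mult.commute)
  also have "\<dots> = (\<integral>y. sphere_moment \<sigma> i * (norm (orth_part y a) ^ i * (b \<bullet> y) ^ e) \<partial>\<sigma>)"
    using integral_inner_power[OF subspace_UNIV sphere] by (simp add: closest_point_self mult.assoc)
  finally show ?thesis by simp
qed

text \<open>For a fixed subspace the two factors are independent, and neither mean depends on the
  subspace.\<close>

lemma section_pair_norm_moment:
  "(\<integral>p. norm (closest_point (H (fst p)) (fst (snd p))) ^ e
        * norm (snd (snd p) - closest_point (H (fst p)) (snd (snd p))) ^ i \<partial>(M \<Otimes>\<^sub>M (\<sigma> \<Otimes>\<^sub>M \<sigma>))) =
    proj_moment e * coproj_moment i"
proof -
  let ?f = "\<lambda>p. norm (closest_point (H (fst p)) (fst (snd p))) ^ e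
        * norm (snd (snd p) - closest_point (H (fst p)) (snd (snd p))) ^ i"
  let ?L = "M \<Otimes>\<^sub>M (\<sigma> \<Otimes>\<^sub>M \<sigma>)"
  have [measurable]: "(\<lambda>p. closest_point (H (fst p)) (fst (snd p))) \<in> borel_measurable ?L"
    "(\<lambda>p. closest_point (H (fst p)) (snd (snd p))) \<in> borel_measurable ?L"
    by (intro proj_pair_measurable; measurable)+
  have bd: "norm (closest_point (H \<omega>) y) \<le> 1" "norm (y - closest_point (H \<omega>) y) \<le> 1"
    if "\<omega> \<in> space M" "norm y = 1" for \<omega> y
  proof -
    note P = closest_point_subspace_inner[OF H_subspace[OF that(1)], of y]
    show "norm (closest_point (H \<omega>) y) \<le> 1" using P(5) that by simp
    have "(norm (y - closest_point (H \<omega>) y))\<^sup>2 \<le> 1\<^sup>2"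
      unfolding P(4) using that by simp
    thus "norm (y - closest_point (H \<omega>) y) \<le> 1"
      by (rule power2_le_imp_le) simp
  qed
  have bd2: "norm (norm p ^ e * norm q ^ i) \<le> 1" if "norm p \<le> 1" "norm q \<le> 1" for p q :: 'a
    using that by (simp add: abs_mult mult_le_one power_le_one)
  have inner: "(\<integral>z. ?f (\<omega>, z) \<partial>(\<sigma> \<Otimes>\<^sub>M \<sigma>)) = proj_moment e * coproj_moment i" if om: "\<omega> \<in> space M" for \<omega>
  proof -
    have [measurable]: "closest_point (H \<omega>) \<in> borel_measurable borel"
      using linear_closest_point_subspace[OF H_subspace[OF om]]
      by (intro borel_measurable_continuous_onI linear_continuous_on) (simp add: linear_conv_bounded_linear)
    have "integrable (\<sigma> \<Otimes>\<^sub>M \<sigma>) (\<lambda>z. ?f (\<omega>, z))"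
    proof (rule sphere2.integrable_const_bound[of _ 1])
      show "AE z in \<sigma> \<Otimes>\<^sub>M \<sigma>. norm (?f (\<omega>, z)) \<le> 1"
        using norm_sphere2 bd[OF om] by (intro AE_I2 bd2) auto
    qed (simp, measurable)
    hence "(\<integral>z. ?f (\<omega>, z) \<partial>(\<sigma> \<Otimes>\<^sub>M \<sigma>)) = (\<integral>y. (\<integral>y'. ?f (\<omega>, (y, y')) \<partial>\<sigma>) \<partial>\<sigma>)"
      by (rule sphere2.integral_fst'[symmetric])
    also have "\<dots> = (\<integral>y. norm (closest_point (H \<omega>) y) ^ e \<partial>\<sigma>) * (\<integral>y. norm (y - closest_point (H \<omega>) y) ^ i \<partial>\<sigma>)"
      by simp
    also have "\<dots> = proj_moment e * coproj_moment i"
      unfolding proj_moment_def coproj_moment_def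
      using proj_moment_const[OF H_grassmannian[OF om] reference_subspace] by simp
    finally show ?thesis .
  qed
  have "integrable ?L ?f"
  proof (rule PM.integrable_const_bound[of _ 1])
    show "AE p in ?L. norm (?f p) \<le> 1"
      using norm_sphere2 bd by (intro AE_I2 bd2) (auto simp: space_pair_measure[of M])
  qed measurable
  hence "(\<integral>p. ?f p \<partial>?L) = (\<integral>\<omega>. (\<integral>z. ?f (\<omega>, z) \<partial>(\<sigma> \<Otimes>\<^sub>M \<sigma>)) \<partial>M)"
    by (rule PM.integral_fst'[symmetric])
  also have "\<dots> = (\<integral>\<omega>. proj_moment e * coproj_moment i \<partial>M)"
    by (intro Bochner_Integration.integral_cong refl inner)
  finally show ?thesis by (simp add: prob_space)
qed

text \<open>The mean of the distance to a \<open>k\<close>-dimensional subspace, raised to the power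
  \<open>i\<close>, relative to the same mean for a line.\<close>

definition "transfer_coeff i = coproj_moment i / orth_moment i"

lemma orth_moment_pos: "even i \<Longrightarrow> orth_moment i > 0"
  unfolding orth_moment_def using k by (intro orth_part_moment_pos[OF sphere]) auto

text \<open>Read as a conditional expectation: given that \<open>x\<close> lies in the random
  subspace, the mean power of the distance of \<open>a\<close> to the subspace is
  \<open>transfer_coeff i\<close> times the same power of its distance to the line through
  \<open>x\<close>. For even \<open>e\<close> the pair from the section and the pair from the sphere
  share a factor \<open>\<kappa>\<close>, which cancels.\<close>

lemma section_mean_transfer_inner_power:
  assumes a: "norm a = 1" and i: "even i"
  shows "expectation (\<lambda>\<omega>. norm (a - closest_point (H \<omega>) a) ^ i * section_mean (\<lambda>x. (b \<bullet> x) ^ e) \<omega>) =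
    transfer_coeff i * (\<integral>y. norm (orth_part y a) ^ i * (b \<bullet> y) ^ e \<partial>\<sigma>)"
proof -
  have "expectation (\<lambda>\<omega>. norm (a - closest_point (H \<omega>) a) ^ i * section_mean (\<lambda>x. (b \<bullet> x) ^ e) \<omega>) =
    expectation (\<lambda>\<omega>. section_moment e * (norm (a - closest_point (H \<omega>) a) ^ i * norm (closest_point (H \<omega>) b) ^ e))"
    by (intro Bochner_Integration.integral_cong refl) (simp add: section_mean_inner_power)
  hence lhs: "expectation (\<lambda>\<omega>. norm (a - closest_point (H \<omega>) a) ^ i * section_mean (\<lambda>x. (b \<bullet> x) ^ e) \<omega>) =
    section_moment e * expectation (\<lambda>\<omega>. norm (a - closest_point (H \<omega>) a) ^ i * norm (closest_point (H \<omega>) b) ^ e)"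
    (is "_ = _ * ?E") by simp
  let ?S = "\<sigma> \<Otimes>\<^sub>M \<sigma>"
  let ?I = "\<integral>y. norm (orth_part y a) ^ i * (b \<bullet> y) ^ e \<partial>\<sigma>"
  have mi: "sphere_moment \<sigma> i > 0"
    by (rule sphere_moment_even_pos[OF subspace_UNIV sphere i])
  show ?thesis
  proof (cases "even e")
    \<comment> \<open>For odd \<open>e\<close> both sides vanish: the right one under
      \<open>y \<mapsto> - y\<close>, the left one through the odd section moment.\<close>
    case False
    have "?I = (\<integral>y. norm (orth_part (- y) a) ^ i * (b \<bullet> - y) ^ e \<partial>\<sigma>)"
    proof (rule integral_rotation_invariant[OF sphere, symmetric])
      show "(\<lambda>y. norm (orth_part y a) ^ i * (b \<bullet> y) ^ e) \<in> borel_measurable borel"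
        unfolding orth_part_def by measurable
    qed (auto simp: orthogonal_transformation_neg image_iff intro: exI[of _ "- _"])
    also have "\<dots> = - ?I"
      using False by (simp add: orth_part_def)
    finally have "?I = 0" by simp
    moreover have "section_moment e = 0"
      using False reference_subspace section_inv unfolding section_moment_def
      by (intro sphere_moment_odd) (auto simp: grassmannian_def)
    ultimately show ?thesis using lhs by simp
  next
    case True
    obtain \<beta> r w where w: "a \<bullet> w = 0" "norm w = 1" and b: "b = \<beta> *\<^sub>R a + r *\<^sub>R w"
      using orth_complement_unit_vector[OF a] k by (metis One_nat_def Suc_leI le_less_trans not_less numeral_2_eq_2 Suc_le_eq)
    define \<kappa> where "\<kappa> = (\<integral>z. (w \<bullet> fst z) ^ i * (a \<bullet> ((\<beta> * norm (orth_part (fst z) (snd z))) *\<^sub>R fst z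
            + r *\<^sub>R orth_part (fst z) (snd z))) ^ e \<partial>?S)"
    \<comment> \<open>The pair \<open>(P y, y' - P y')\<close> with \<open>P\<close> the projection
      onto the random subspace.\<close>
    have 1: "sphere_moment \<sigma> i * sphere_moment \<sigma> e * ?E * orth_moment e = proj_moment e * coproj_moment i * \<kappa>"
    proof -
      let ?L = "M \<Otimes>\<^sub>M ?S"
      let ?X = "\<lambda>p. closest_point (H (fst p)) (fst (snd p))"
      let ?U = "\<lambda>p. snd (snd p) - closest_point (H (fst p)) (snd (snd p))"
      have [measurable]: "?X \<in> borel_measurable ?L"
        "(\<lambda>p. closest_point (H (fst p)) (snd (snd p))) \<in> borel_measurable ?L"
        by (intro proj_pair_measurable; measurable)+
      have "(\<integral>p. (?U p \<bullet> a) ^ i * (?X p \<bullet> (\<beta> *\<^sub>R a + r *\<^sub>R w)) ^ e \<partial>?L) * orth_moment e =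
          (\<integral>p. norm (?X p) ^ e * norm (?U p) ^ i \<partial>?L) * \<kappa>"
        unfolding orth_moment_def \<kappa>_def
      proof (rule orthogonal_pair_moment[OF sphere PM.prob_space_axioms])
        show "?U \<in> borel_measurable ?L" by measurable
        fix p assume p: "p \<in> space ?L"
        hence n: "norm (fst (snd p)) = 1" "norm (snd (snd p)) = 1" and om: "fst p \<in> space M"
          using norm_sphere2[of "snd p"] by (auto simp: space_pair_measure[of M])
        note P = closest_point_subspace_inner[OF H_subspace[OF om]]
        show "?X p \<bullet> ?U p = 0"
          using closest_point_orth_decomp[OF H_subspace[OF om]] by (simp add: inner_commute)
        show "norm (?X p) \<le> 1" using P(5) n by metis
        have "(norm (?U p))\<^sup>2 \<le> 1\<^sup>2" unfolding P(4) using n by simp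
        thus "norm (?U p) \<le> 1" by (rule power2_le_imp_le) simp
      qed (use w a section_pair_inner_power section_pair_invariant in auto)
      thus ?thesis
        unfolding b[symmetric] section_pair_inner_power section_pair_norm_moment .
    qed
    \<comment> \<open>The pair \<open>(y, orth_part y y')\<close> with the same test vectors, hence
      the same \<open>\<kappa>\<close>.\<close>
    have 2: "sphere_moment \<sigma> i * ?I * orth_moment e = orth_moment i * \<kappa>"
    proof -
      let ?U = "\<lambda>z::'a\<times>'a. orth_part (fst z) (snd z)"
      have [measurable]: "?U \<in> borel_measurable ?S"
        unfolding orth_part_def by measurable
      have "(\<integral>z. (?U z \<bullet> a) ^ i * (fst z \<bullet> (\<beta> *\<^sub>R a + r *\<^sub>R w)) ^ e \<partial>?S) * orth_moment e =
          (\<integral>z. norm (fst z) ^ e * norm (?U z) ^ i \<partial>?S) * \<kappa>"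
        unfolding orth_moment_def \<kappa>_def
      proof (rule orthogonal_pair_moment[OF sphere sphere2.prob_space_axioms])
        fix z assume z: "z \<in> space ?S"
        show "fst z \<bullet> ?U z = 0" "norm (fst z) \<le> 1" "norm (?U z) \<le> 1"
          using norm_sphere2[OF z] norm_orth_part_le[of "fst z" "snd z"] by (auto simp: orth_part_orthogonal)
      next
        fix g :: "'a \<Rightarrow> 'a" and c d assume g: "orthogonal_transformation g"
        have inner: "g x \<bullet> g y = x \<bullet> y" for x y using g by (simp add: orthogonal_transformation_def)
        have "(\<integral>z. (?U z \<bullet> g c) ^ i * (fst z \<bullet> g d) ^ e \<partial>?S) =
            (\<integral>z. (?U (g (fst z), g (snd z)) \<bullet> g c) ^ i * (fst (g (fst z), g (snd z)) \<bullet> g d) ^ e \<partial>?S)"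
          by (rule integral_pair_rotation_invariant[OF sphere g, symmetric]) measurable
        thus "(\<integral>z. (?U z \<bullet> g c) ^ i * (fst z \<bullet> g d) ^ e \<partial>?S) = (\<integral>z. (?U z \<bullet> c) ^ i * (fst z \<bullet> d) ^ e \<partial>?S)"
          by (simp add: orth_part_orthogonal_transformation[OF g] inner)
      qed (use w a in auto)
      moreover have "(\<integral>z. norm (fst z) ^ e * norm (?U z) ^ i \<partial>?S) = orth_moment i"
        unfolding orth_moment_def
        by (intro Bochner_Integration.integral_cong) (auto dest: norm_sphere2)
      ultimately show ?thesis
        unfolding b[symmetric] sphere_pair_inner_power by simp
    qed
    have "sphere_moment \<sigma> i * sphere_moment \<sigma> e * ?E * orth_moment i =
        proj_moment e * coproj_moment i * (sphere_moment \<sigma> i * ?I)"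
      by (rule cross_ratio_eq[OF 1 2]) (rule orth_moment_pos[OF True])
    hence "sphere_moment \<sigma> e * ?E * orth_moment i = proj_moment e * coproj_moment i * ?I"
      using mi by simp
    moreover have m: "section_moment e * proj_moment e = sphere_moment \<sigma> e"
      by (rule section_moment_proj_moment)
    moreover have "proj_moment e \<noteq> 0"
      using m sphere_moment_even_pos[OF subspace_UNIV sphere True] by auto
    ultimately have "section_moment e * ?E * orth_moment i = coproj_moment i * ?I"
      by (simp flip: m add: mult_ac)
    thus ?thesis
      unfolding lhs transfer_coeff_def using orth_moment_pos[OF i] by (simp add: field_simps)
  qed
qed

end

subsection \<open>Ridge polynomials\<close>

text \<open>\<open>D\<close> is only an upper bound on the degrees, so these spaces form a
  filtration. Unit directions make \<open>|P a|^2 = 1 - |a - P a|^2\<close> available for every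
  generator and every orthogonal projection \<open>P\<close>.\<close>

inductive ridge_poly :: "nat \<Rightarrow> ('a::euclidean_space \<Rightarrow> real) \<Rightarrow> bool" for D where
  ridge_power: "d \<le> D \<Longrightarrow> norm a = 1 \<Longrightarrow> ridge_poly D (\<lambda>x. (a \<bullet> x) ^ d)"
| ridge_add: "ridge_poly D f \<Longrightarrow> ridge_poly D g \<Longrightarrow> ridge_poly D (\<lambda>x. f x + g x)"
| ridge_mult: "ridge_poly D f \<Longrightarrow> ridge_poly D (\<lambda>x. c * f x)"

lemma ridge_poly_mono: "ridge_poly D f \<Longrightarrow> D \<le> D' \<Longrightarrow> ridge_poly D' f"
  by (induction rule: ridge_poly.induct) (auto intro: ridge_poly.intros)

lemma ridge_poly_continuous: "ridge_poly D f \<Longrightarrow> continuous_on S f"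
  by (induction rule: ridge_poly.induct) (intro continuous_intros; assumption)+

lemma ridge_poly_measurable: "ridge_poly D f \<Longrightarrow> f \<in> borel_measurable borel"
  by (intro borel_measurable_continuous_onI ridge_poly_continuous)

lemma ridge_poly_0: "ridge_poly 0 f \<Longrightarrow> \<exists>c. f = (\<lambda>_. c)"
  by (induction rule: ridge_poly.induct) auto

lemma ridge_poly_const: "ridge_poly D (\<lambda>x::'a::euclidean_space. c)"
proof -
  obtain a :: 'a where "norm a = 1" by (metis norm_Basis nonempty_Basis ex_in_conv)
  from ridge_mult[OF ridge_power[OF le0 this], of D c] show ?thesis by simp
qed

lemma ridge_poly_sum:
  assumes "\<And>i. i \<in> I \<Longrightarrow> ridge_poly D (f i)"
  shows "ridge_poly D (\<lambda>x. \<Sum>i\<in>I. f i x)"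
  using assms
  by (induction I rule: infinite_finite_induct) (simp_all add: ridge_poly_const ridge_add)

lemma ridge_poly_poly:
  assumes "degree p \<le> D" "norm a = 1"
  shows "ridge_poly D (\<lambda>x. poly p (a \<bullet> x))"
  unfolding poly_altdef using assms
  by (intro ridge_poly_sum ridge_mult ridge_power) auto

lemma continuous_bounded_on_sphere:
  fixes f :: "'a::euclidean_space \<Rightarrow> real"
  assumes "continuous_on UNIV f"
  obtains C where "C \<ge> 0" "\<And>x. norm x = 1 \<Longrightarrow> \<bar>f x\<bar> \<le> C"
proof -
  have "compact (f ` sphere 0 1)"
    by (intro compact_continuous_image continuous_on_subset[OF assms]) auto
  then obtain C where C: "\<And>x. x \<in> sphere 0 1 \<Longrightarrow> \<bar>f x\<bar> \<le> C"
    by (force dest!: compact_imp_bounded simp: bounded_iff)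
  show ?thesis
    by (rule that[of "max C 0"]) (use C in \<open>auto simp: le_max_iff_disj\<close>)
qed

section \<open>Section means of ridge polynomials\<close>

context random_section
begin

lemma section_mean_add:
  assumes "\<omega> \<in> space M" "continuous_on UNIV f" "continuous_on UNIV g"
  shows "section_mean (\<lambda>x. f x + g x) \<omega> = section_mean f \<omega> + section_mean g \<omega>"
  unfolding section_mean_def
  by (intro Bochner_Integration.integral_add
      integrable_rotation_invariant_continuous[OF section_inv[OF H_grassmannian[OF assms(1)]]] assms)

lemma section_mean_mult: "section_mean (\<lambda>x. c * f x) \<omega> = c * section_mean f \<omega>"
  by (simp add: section_mean_def)

lemma section_mean_const: "\<omega> \<in> space M \<Longrightarrow> section_mean (\<lambda>x. c) \<omega> = c"
  using rotation_invariant_prob_space[OF section_inv[OF H_grassmannian]]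
  by (simp add: section_mean_def prob_space.prob_space)

lemma section_mean_bound:
  assumes "\<omega> \<in> space M" "f \<in> borel_measurable borel" "\<And>x. norm x = 1 \<Longrightarrow> \<bar>f x\<bar> \<le> C"
  shows "\<bar>section_mean f \<omega>\<bar> \<le> C"
proof -
  note inv = section_inv[OF H_grassmannian[OF assms(1)]]
  interpret S: prob_space "\<sigma>\<^sub>H (H \<omega>)" by (rule rotation_invariant_prob_space[OF inv])
  have int: "integrable (\<sigma>\<^sub>H (H \<omega>)) f"
    using assms by (intro integrable_rotation_invariant[OF inv]) auto
  have ae: "AE x in \<sigma>\<^sub>H (H \<omega>). \<bar>f x\<bar> \<le> C"
    using assms(3) by (intro AE_I2) (auto simp: space_rotation_invariant[OF inv])
  hence "section_mean f \<omega> \<le> C" "section_mean f \<omega> \<ge> - C"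
    unfolding section_mean_def
    by (intro S.integral_le_const S.integral_ge_const int; auto elim!: eventually_mono)+
  thus ?thesis by linarith
qed

text \<open>Each generator has an explicit section mean, and linearity does the rest.\<close>

lemma section_mean_measurable_ridge [measurable]:
  assumes "ridge_poly D f"
  shows "section_mean f \<in> borel_measurable M"
  using assms
proof (induction rule: ridge_poly.induct)
  case (ridge_power d a)
  have "(\<lambda>\<omega>. section_moment d * norm (closest_point (H \<omega>) a) ^ d) \<in> borel_measurable M"
    by measurable
  thus ?case
    by (subst measurable_cong[OF section_mean_inner_power])
next
  case (ridge_add f g)
  have "(\<lambda>\<omega>. section_mean f \<omega> + section_mean g \<omega>) \<in> borel_measurable M"
    using ridge_add by measurable
  thus ?case
    using ridge_add by (subst measurable_cong[OF section_mean_add]) (auto intro: ridge_poly_continuous)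
next
  case (ridge_mult f c)
  thus ?case by (subst measurable_cong[OF section_mean_mult]) measurable
qed

lemma section_mean_ridge_bound:
  assumes "ridge_poly D f"
  obtains C where "C \<ge> 0" "\<And>\<omega>. \<omega> \<in> space M \<Longrightarrow> \<bar>section_mean f \<omega>\<bar> \<le> C"
proof -
  obtain C where C: "C \<ge> 0" "\<And>x. norm x = 1 \<Longrightarrow> \<bar>f x\<bar> \<le> C"
    using continuous_bounded_on_sphere[OF ridge_poly_continuous[OF assms]] by blast
  show ?thesis
    by (rule that[OF C(1)]) (rule section_mean_bound[OF _ ridge_poly_measurable[OF assms] C(2)])
qed

lemma integrable_section_mean_mult:
  assumes [measurable]: "\<phi> \<in> borel_measurable M" and \<phi>: "\<And>\<omega>. \<omega> \<in> space M \<Longrightarrow> \<bar>\<phi> \<omega>\<bar> \<le> B"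
    and f: "ridge_poly D f"
  shows "integrable M (\<lambda>\<omega>. \<phi> \<omega> * section_mean f \<omega>)"
proof -
  note [measurable] = section_mean_measurable_ridge[OF f]
  obtain C where C: "C \<ge> 0" "\<And>\<omega>. \<omega> \<in> space M \<Longrightarrow> \<bar>section_mean f \<omega>\<bar> \<le> C"
    using section_mean_ridge_bound[OF f] by blast
  show ?thesis
  proof (rule integrable_const_bound[of _ "B * C"])
    show "AE \<omega> in M. norm (\<phi> \<omega> * section_mean f \<omega>) \<le> B * C"
      using \<phi> C by (intro AE_I2) (auto simp: abs_mult intro!: mult_mono intro: order_trans[OF abs_ge_zero])
  qed measurable
qed

lemma integrable_section_mean_product:
  assumes "ridge_poly D f" "ridge_poly D' g"
  shows "integrable M (\<lambda>\<omega>. section_mean f \<omega> * section_mean g \<omega>)"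
  using section_mean_ridge_bound[OF assms(1)]
  by (metis integrable_section_mean_mult section_mean_measurable_ridge assms)

lemma integrable_sphere_mult:
  fixes f g :: "'a \<Rightarrow> real"
  assumes "continuous_on UNIV f" "continuous_on UNIV g"
  shows "integrable \<sigma> (\<lambda>x. f x * g x)"
  using assms by (intro integrable_rotation_invariant_continuous[OF sphere] continuous_intros)

lemma norm_coproj_le:
  assumes "\<omega> \<in> space M" "norm a = 1"
  shows "norm (a - closest_point (H \<omega>) a) \<le> 1"
proof (rule power2_le_imp_le)
  show "(norm (a - closest_point (H \<omega>) a))\<^sup>2 \<le> 1\<^sup>2"
    unfolding closest_point_subspace_inner(4)[OF H_subspace[OF assms(1)]] using assms(2) by simp
qed simp

lemma continuous_on_orth_part_norm: "continuous_on S (\<lambda>y. norm (orth_part y a) ^ i)"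
  unfolding orth_part_def by (intro continuous_intros)

text \<open>In operator terms, the adjoint of \<open>section_mean\<close> sends a power of the
  distance of \<open>a\<close> to the subspace to a multiple of the same power of
  \<open>norm (orth_part y a)\<close>. This is tested against ridge polynomials.\<close>

lemma section_mean_transfer:
  assumes "ridge_poly D g" and a: "norm a = 1" and i: "even i"
  shows "expectation (\<lambda>\<omega>. norm (a - closest_point (H \<omega>) a) ^ i * section_mean g \<omega>) =
    transfer_coeff i * (\<integral>y. norm (orth_part y a) ^ i * g y \<partial>\<sigma>)"
  using assms(1)
proof (induction rule: ridge_poly.induct)
  case (ridge_power d b)
  show ?case by (rule section_mean_transfer_inner_power[OF a i])
next
  case (ridge_add f g)
  let ?\<phi> = "\<lambda>\<omega>. norm (a - closest_point (H \<omega>) a) ^ i"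
  let ?\<psi> = "\<lambda>y. norm (orth_part y a) ^ i"
  have int: "integrable M (\<lambda>\<omega>. ?\<phi> \<omega> * section_mean h \<omega>)" if "ridge_poly D h" for h
    using norm_coproj_le[OF _ a] that
    by (intro integrable_section_mean_mult[of _ 1]) (auto intro: power_le_one)
  have int': "integrable \<sigma> (\<lambda>y. ?\<psi> y * h y)" if "ridge_poly D h" for h
    by (intro integrable_sphere_mult ridge_poly_continuous[OF that] continuous_on_orth_part_norm)
  have "expectation (\<lambda>\<omega>. ?\<phi> \<omega> * section_mean (\<lambda>x. f x + g x) \<omega>) =
      expectation (\<lambda>\<omega>. ?\<phi> \<omega> * section_mean f \<omega> + ?\<phi> \<omega> * section_mean g \<omega>)"
    using ridge_add(1,2)
    by (intro Bochner_Integration.integral_cong refl)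
      (simp add: section_mean_add ridge_poly_continuous distrib_left)
  also have "\<dots> = transfer_coeff i * ((\<integral>y. ?\<psi> y * f y \<partial>\<sigma>) + (\<integral>y. ?\<psi> y * g y \<partial>\<sigma>))"
    using ridge_add int by (simp add: distrib_left)
  also have "\<dots> = transfer_coeff i * (\<integral>y. ?\<psi> y * (f y + g y) \<partial>\<sigma>)"
    using int' ridge_add(1,2) by (simp add: distrib_left)
  finally show ?case .
next
  case (ridge_mult f c)
  have *: "x * (c * z) = c * (x * z)" for x z :: real by simp
  show ?case
    unfolding section_mean_mult * using ridge_mult.IH by simp
qed

text \<open>The exponent 0 in the transfer identity, where the coefficient is 1.\<close>

lemma expectation_section_mean_ridge:
  assumes "ridge_poly D f"
  shows "expectation (section_mean f) = (\<integral>x. f x \<partial>\<sigma>)"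
proof -
  obtain a :: 'a where "norm a = 1" by (metis norm_Basis nonempty_Basis ex_in_conv)
  moreover have "transfer_coeff 0 = 1"
    by (simp add: transfer_coeff_def coproj_moment_def orth_moment_def sphere.prob_space sphere2.prob_space)
  ultimately show ?thesis
    using section_mean_transfer[OF assms, of a 0] by simp
qed

section \<open>The diagonal entries in each degree\<close>

definition "section_eigenvalue d = section_moment d * transfer_coeff d"

text \<open>The diagonal entry in degree 2, since \<open>section_moment 2 = 1 / k\<close>.\<close>

definition "spectral_bound = transfer_coeff 2 / k"

lemma section_moment_2: "section_moment 2 = 1 / k"
  using sphere_moment_2[OF _ section_inv[OF reference_subspace]] reference_subspace k
  by (simp add: section_moment_def grassmannian_def field_simps)

lemma sphere_moment_2_UNIV: "sphere_moment \<sigma> 2 = 1 / DIM('a)"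
  using sphere_moment_2[OF subspace_UNIV sphere] by (simp add: field_simps)

text \<open>By Pythagoras a mean squared distance is 1 minus a mean squared projection. In dimension
  \<open>n\<close> the latter is \<open>k / n\<close> for the subspace, as the quotient of the
  second moments \<open>1 / n\<close> and \<open>1 / k\<close>, and \<open>1 / n\<close> for the
  line.\<close>

lemma transfer_coeff_2: "transfer_coeff 2 = (real DIM('a) - real k) / (real DIM('a) - 1)"
proof -
  have K: "subspace reference_subspace" using reference_subspace by (simp add: grassmannian_def)
  note P = closest_point_subspace_inner[OF K]
  have [measurable]: "closest_point reference_subspace \<in> borel_measurable borel"
    using linear_closest_point_subspace[OF K]
    by (intro borel_measurable_continuous_onI linear_continuous_on) (simp add: linear_conv_bounded_linear)
  have "proj_moment 2 = real k / DIM('a)"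
    using section_moment_proj_moment[of 2] k by (simp add: section_moment_2 sphere_moment_2_UNIV field_simps)
  moreover have "coproj_moment 2 = 1 - proj_moment 2"
  proof -
    have "integrable \<sigma> (\<lambda>y. (norm (closest_point reference_subspace y))\<^sup>2)"
    proof (intro integrable_rotation_invariant[OF sphere, of _ 1])
      show "\<bar>(norm (closest_point reference_subspace x))\<^sup>2\<bar> \<le> 1" if "x \<in> sphere 0 1" for x
        using P(5)[of x] that by (simp add: abs_square_le_1)
    qed measurable
    hence "(\<integral>y. 1 - (norm (closest_point reference_subspace y))\<^sup>2 \<partial>\<sigma>) = 1 - proj_moment 2"
      by (simp add: proj_moment_def sphere.prob_space)
    moreover have "coproj_moment 2 = (\<integral>y. 1 - (norm (closest_point reference_subspace y))\<^sup>2 \<partial>\<sigma>)"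
      unfolding coproj_moment_def P(4)
      by (intro Bochner_Integration.integral_cong refl) (simp add: norm_sphere[OF sphere])
    ultimately show ?thesis by simp
  qed
  moreover have "orth_moment 2 = 1 - 1 / DIM('a)"
  proof -
    have int: "integrable (\<sigma> \<Otimes>\<^sub>M \<sigma>) (\<lambda>z. (snd z \<bullet> fst z)\<^sup>2)"
      using norm_sphere2 abs_inner_power_le[of "fst _" "snd _" 2]
      by (intro sphere2.integrable_const_bound[of _ 1] AE_I2) (auto simp: abs_square_le_1 intro: order_trans[OF Cauchy_Schwarz_ineq2])
    have "orth_moment 2 = (\<integral>z. 1 - (snd z \<bullet> fst z)\<^sup>2 \<partial>(\<sigma> \<Otimes>\<^sub>M \<sigma>))"
      unfolding orth_moment_def
      by (intro Bochner_Integration.integral_cong refl) (auto dest!: norm_sphere2 simp: norm_orth_part_sq)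
    also have "\<dots> = 1 - (\<integral>z. (snd z \<bullet> fst z)\<^sup>2 \<partial>(\<sigma> \<Otimes>\<^sub>M \<sigma>))"
      using int by (simp add: sphere2.prob_space)
    also have "(\<integral>z. (snd z \<bullet> fst z)\<^sup>2 \<partial>(\<sigma> \<Otimes>\<^sub>M \<sigma>)) = (\<integral>y. (\<integral>x. (x \<bullet> y)\<^sup>2 \<partial>\<sigma>) \<partial>\<sigma>)"
      using sphere2.integral_fst'[OF int] by simp
    also have "\<dots> = sphere_moment \<sigma> 2"
      by (simp add: sphere_moment_def inner_commute)
    finally show ?thesis by (simp add: sphere_moment_2_UNIV)
  qed
  ultimately have "coproj_moment 2 = 1 - real k / DIM('a)" "orth_moment 2 = 1 - 1 / DIM('a)"
    by simp_all
  hence "coproj_moment 2 = (real DIM('a) - real k) / DIM('a)"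
    "orth_moment 2 = (real DIM('a) - 1) / DIM('a)"
    by (simp_all add: diff_divide_distrib)
  thus ?thesis
    using k by (simp add: transfer_coeff_def)
qed

lemma transfer_coeff_nonneg: "even d \<Longrightarrow> transfer_coeff d \<ge> 0"
  using orth_moment_pos[of d] unfolding transfer_coeff_def coproj_moment_def
  by (intro divide_nonneg_pos Bochner_Integration.integral_nonneg) simp_all

text \<open>Allows the integral to be cancelled in \<open>transfer_coeff_le\<close>. If it vanished,
  \<open>y\<close> would be \<open>a\<close> or \<open>- a\<close> almost everywhere, against the
  second moment \<open>1 / DIM('a)\<close>.\<close>

lemma integral_orth_part_power_pos:
  assumes a: "norm a = 1"
  shows "(\<integral>y. norm (orth_part y a) ^ i \<partial>\<sigma>) > 0"
proof -
  have int: "integrable \<sigma> (\<lambda>y. norm (orth_part y a) ^ i)"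
    by (intro integrable_rotation_invariant_continuous[OF sphere] continuous_on_orth_part_norm)
  have "(\<integral>y. norm (orth_part y a) ^ i \<partial>\<sigma>) \<ge> 0"
    by (intro Bochner_Integration.integral_nonneg) simp
  moreover have False if "(\<integral>y. norm (orth_part y a) ^ i \<partial>\<sigma>) = 0"
  proof -
    have "AE y in \<sigma>. norm (orth_part y a) ^ i = 0"
      using that integral_nonneg_eq_0_iff_AE[OF int] by simp
    hence "AE y in \<sigma>. (a \<bullet> y)\<^sup>2 = 1"
      using AE_space
    proof eventually_elim
      case (elim y)
      thus ?case using norm_orth_part_sq[of y a] a by (simp add: norm_sphere[OF sphere])
    qed
    hence "(\<integral>y. (a \<bullet> y)\<^sup>2 \<partial>\<sigma>) = (\<integral>y. 1 \<partial>\<sigma>)"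
      by (intro integral_cong_AE) auto
    hence "sphere_moment \<sigma> 2 = 1"
      using sphere_moment_eq[OF subspace_UNIV sphere _ a] by (simp add: sphere.prob_space)
    thus False using k by (simp add: sphere_moment_2_UNIV)
  qed
  ultimately show ?thesis by (metis order_le_less)
qed

lemma norm_orth_part_even_power:
  assumes "norm y = 1" "norm a = 1"
  shows "norm (orth_part y a) ^ (2 * j) = (1 - (a \<bullet> y)\<^sup>2) ^ j"
  using norm_orth_part_sq[OF assms(1), of a] assms(2) by (simp add: power_mult)

text \<open>
  On \<open>H \<omega>\<close> one has \<open>1 - (a \<bullet> x)\<^sup>2 \<ge> (norm (a - closest_point (H \<omega>) a))\<^sup>2\<close>, so one factor of
  the moment of order \<open>d\<close> can be kept and the others transferred to the sphere.
\<close>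

lemma transfer_coeff_le:
  assumes "even d" "d \<ge> 2"
  shows "transfer_coeff d \<le> transfer_coeff 2"
proof -
  obtain a :: 'a where a: "norm a = 1" by (metis norm_Basis nonempty_Basis ex_in_conv)
  obtain j where d: "d = 2 * Suc j"
    using assms by (metis evenE mult_0_right not0_implies_Suc not_numeral_le_zero)
  let ?I = "\<integral>y. norm (orth_part y a) ^ d \<partial>\<sigma>"
  let ?g = "\<lambda>x. (1 - (a \<bullet> x)\<^sup>2) ^ j"
  have g: "ridge_poly (2 * j) ?g"
  proof -
    have "degree ([:1, 0, -1:] ^ j :: real poly) \<le> 2 * j"
      by (rule order_trans[OF degree_power_le]) simp
    from ridge_poly_poly[OF this a] show ?thesis
      by (simp add: poly_power power2_eq_square)
  qed
  \<comment> \<open>The transfer identity for the constant function 1.\<close>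
  have 1: "expectation (\<lambda>\<omega>. norm (a - closest_point (H \<omega>) a) ^ d) = transfer_coeff d * ?I"
    using section_mean_transfer[OF ridge_poly_const[of 0 1] a assms(1)]
    by (simp add: section_mean_const cong: Bochner_Integration.integral_cong)
  have "expectation (\<lambda>\<omega>. norm (a - closest_point (H \<omega>) a) ^ d) \<le>
      expectation (\<lambda>\<omega>. norm (a - closest_point (H \<omega>) a) ^ 2 * section_mean ?g \<omega>)"
  proof (rule integral_mono)
    show "integrable M (\<lambda>\<omega>. norm (a - closest_point (H \<omega>) a) ^ 2 * section_mean ?g \<omega>)"
      using norm_coproj_le[OF _ a]
      by (intro integrable_section_mean_mult[OF _ _ g, of _ 1]) (auto intro: power_le_one)
    show "integrable M (\<lambda>\<omega>. norm (a - closest_point (H \<omega>) a) ^ d)"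
      using norm_coproj_le[OF _ a] by (intro integrable_const_bound[of _ 1] AE_I2) (auto intro: power_le_one)
    fix \<omega> assume om: "\<omega> \<in> space M"
    note inv = section_inv[OF H_grassmannian[OF om]]
    note P = closest_point_subspace_inner[OF H_subspace[OF om]]
    interpret S: prob_space "\<sigma>\<^sub>H (H \<omega>)" by (rule rotation_invariant_prob_space[OF inv])
    let ?n = "norm (a - closest_point (H \<omega>) a)"
    have n: "?n\<^sup>2 = 1 - (norm (closest_point (H \<omega>) a))\<^sup>2" unfolding P(4) using a by simp
    have "(?n\<^sup>2) ^ j \<le> section_mean ?g \<omega>"
      unfolding section_mean_def
    proof (rule S.integral_ge_const)
      show "integrable (\<sigma>\<^sub>H (H \<omega>)) ?g"
        by (intro integrable_rotation_invariant_continuous[OF inv] ridge_poly_continuous[OF g])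
      show "AE x in \<sigma>\<^sub>H (H \<omega>). (?n\<^sup>2) ^ j \<le> ?g x"
      proof (rule AE_I2)
        fix x assume "x \<in> space (\<sigma>\<^sub>H (H \<omega>))"
        hence x: "x \<in> H \<omega>" "norm x = 1" by (auto simp: space_rotation_invariant[OF inv])
        have "\<bar>a \<bullet> x\<bar> \<le> norm (closest_point (H \<omega>) a)"
          using P(1)[OF x(1), of a] Cauchy_Schwarz_ineq2[of "closest_point (H \<omega>) a" x] x(2) by simp
        hence "(a \<bullet> x)\<^sup>2 \<le> (norm (closest_point (H \<omega>) a))\<^sup>2"
          by (metis abs_le_square_iff abs_norm_cancel)
        thus "(?n\<^sup>2) ^ j \<le> ?g x"
          using n zero_le_power2[of ?n] by (intro power_mono) linarith+
      qed
    qed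
    thus "?n ^ d \<le> ?n ^ 2 * section_mean ?g \<omega>"
      unfolding d power_mult power_Suc by (rule mult_left_mono) simp
  qed
  also have "\<dots> = transfer_coeff 2 * (\<integral>y. norm (orth_part y a) ^ 2 * ?g y \<partial>\<sigma>)"
    by (rule section_mean_transfer[OF g a]) simp
  \<comment> \<open>The kept factor and the transferred ones recombine to the integral of order
    \<open>d\<close>, so comparing both evaluations leaves only the coefficients.\<close>
  also have "(\<integral>y. norm (orth_part y a) ^ 2 * ?g y \<partial>\<sigma>) = ?I"
  proof (intro Bochner_Integration.integral_cong refl)
    fix y assume "y \<in> space \<sigma>"
    hence y: "norm y = 1" by (rule norm_sphere[OF sphere])
    show "norm (orth_part y a) ^ 2 * ?g y = norm (orth_part y a) ^ d"
      using norm_orth_part_even_power[OF y a, of "Suc j"] norm_orth_part_even_power[OF y a, of 1]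
      by (simp add: d)
  qed
  finally show ?thesis
    using 1 integral_orth_part_power_pos[OF a, of d] by simp
qed

text \<open>Among even degrees from 2 on both factors are largest in degree 2; odd degrees, in
  particular 1, have vanishing section moment.\<close>

lemma section_eigenvalue_bounds:
  assumes "d \<ge> 1"
  shows "0 \<le> section_eigenvalue d" "section_eigenvalue d \<le> spectral_bound"
proof -
  have K: "subspace reference_subspace" using reference_subspace by (simp add: grassmannian_def)
  note inv = section_inv[OF reference_subspace]
  have *: "0 \<le> section_eigenvalue d \<and> section_eigenvalue d \<le> spectral_bound"
  proof (cases "even d")
    case True
    hence d: "d \<ge> 2" using assms by (cases "d = 1") auto
    have "0 < section_moment d" "section_moment d \<le> 1 / k"
      using sphere_moment_even_pos[OF K inv True] sphere_moment_even_le[OF K inv True d]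
      by (simp_all add: section_moment_2[symmetric] section_moment_def)
    moreover have "spectral_bound = (1 / k) * transfer_coeff 2"
      by (simp add: spectral_bound_def)
    ultimately show ?thesis
      unfolding section_eigenvalue_def
      using transfer_coeff_nonneg[OF True] transfer_coeff_le[OF True d]
        mult_mono[of "section_moment d" "1 / k" "transfer_coeff d" "transfer_coeff 2"] by simp
  next
    case False
    hence "section_moment d = 0"
      unfolding section_moment_def by (intro sphere_moment_odd[OF K inv])
    thus ?thesis by (simp add: section_eigenvalue_def spectral_bound_def transfer_coeff_nonneg)
  qed
  show "0 \<le> section_eigenvalue d" "section_eigenvalue d \<le> spectral_bound" using * by auto
qed

lemma spectral_bound_eq: "spectral_bound = (real DIM('a) - real k) / (real k * (real DIM('a) - 1))"
  by (simp add: spectral_bound_def transfer_coeff_2 mult.commute)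

lemma spectral_bound_pos: "spectral_bound > 0"
  unfolding spectral_bound_eq using k by (intro divide_pos_pos mult_pos_pos) auto

end

subsection \<open>The spectral bound on ridge polynomials\<close>

context random_section
begin

text \<open>
  \<open>section_adjoint f h\<close> says that \<open>h\<close> represents \<open>T* T f\<close>, where \<open>T\<close> is \<open>section_mean\<close>,
  tested against ridge polynomials only.
\<close>

definition section_adjoint :: "('a \<Rightarrow> real) \<Rightarrow> ('a \<Rightarrow> real) \<Rightarrow> bool" where
  "section_adjoint f h \<longleftrightarrow> (\<forall>D g. ridge_poly D g \<longrightarrow>
     expectation (\<lambda>\<omega>. section_mean f \<omega> * section_mean g \<omega>) = (\<integral>x. h x * g x \<partial>\<sigma>))"

lemma section_adjoint_add:
  assumes "section_adjoint f h" "section_adjoint f' h'"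
    and "ridge_poly D f" "ridge_poly D f'" "ridge_poly D h" "ridge_poly D h'"
  shows "section_adjoint (\<lambda>x. f x + f' x) (\<lambda>x. h x + h' x)"
  unfolding section_adjoint_def
proof (intro allI impI)
  fix E and g :: "'a \<Rightarrow> real" assume g: "ridge_poly E g"
  have "expectation (\<lambda>\<omega>. section_mean (\<lambda>x. f x + f' x) \<omega> * section_mean g \<omega>) =
      expectation (\<lambda>\<omega>. section_mean f \<omega> * section_mean g \<omega> + section_mean f' \<omega> * section_mean g \<omega>)"
    using assms by (intro Bochner_Integration.integral_cong refl)
      (simp add: section_mean_add ridge_poly_continuous distrib_right)
  also have "\<dots> = (\<integral>x. h x * g x \<partial>\<sigma>) + (\<integral>x. h' x * g x \<partial>\<sigma>)"
    using assms g unfolding section_adjoint_def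
    by (subst Bochner_Integration.integral_add)
      (auto intro: integrable_section_mean_product)
  also have "\<dots> = (\<integral>x. (h x + h' x) * g x \<partial>\<sigma>)"
    using assms g
    by (subst Bochner_Integration.integral_add[symmetric])
      (auto intro: integrable_sphere_mult ridge_poly_continuous simp: distrib_right)
  finally show "expectation (\<lambda>\<omega>. section_mean (\<lambda>x. f x + f' x) \<omega> * section_mean g \<omega>) =
    (\<integral>x. (h x + h' x) * g x \<partial>\<sigma>)" .
qed

lemma section_adjoint_mult:
  "section_adjoint f h \<Longrightarrow> section_adjoint (\<lambda>x. c * f x) (\<lambda>x. c * h x)"
  by (simp add: section_adjoint_def section_mean_mult mult.assoc)

text \<open>For even \<open>d = 2 * j\<close> only the last term of the binomial expansion reaches
  degree \<open>d\<close>. Its sign \<open>(- 1) ^ j\<close> cancels against the leading coefficient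
  of \<open>(1 - t^2) ^ j\<close>, which leaves the eigenvalue itself.\<close>

lemma section_adjoint_ridge_power:
  assumes a: "norm a = 1"
  shows "\<exists>q. degree q \<le> d \<and> coeff q d = section_eigenvalue d \<and>
    section_adjoint (\<lambda>x. (a \<bullet> x) ^ d) (\<lambda>x. poly q (a \<bullet> x))"
proof (cases "even d")
  case False
  have "section_moment d = 0"
    using False reference_subspace section_inv unfolding section_moment_def
    by (intro sphere_moment_odd) (auto simp: grassmannian_def)
  hence "section_adjoint (\<lambda>x. (a \<bullet> x) ^ d) (\<lambda>x. poly 0 (a \<bullet> x))" "section_eigenvalue d = 0"
    unfolding section_adjoint_def section_eigenvalue_def
    by (simp_all add: section_mean_inner_power cong: Bochner_Integration.integral_cong)
  thus ?thesis by (intro exI[of _ 0]) simp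
next
  case True
  then obtain j where d: "d = 2 * j" by (elim evenE)
  define b where "b i = real (j choose i) * (- 1) ^ i" for i
  define s :: "real poly" where "s = [:1, 0, -1:]"
  \<comment> \<open>The expansion of \<open>(1 - t) ^ j\<close> for \<open>t = |a - P a|^2\<close>,
    with each \<open>t ^ i\<close> replaced by its transferred image
    \<open>transfer_coeff (2 * i)\<close> times \<open>s ^ i\<close>.\<close>
  define q where "q = (\<Sum>i\<le>j. smult (section_moment d * b i * transfer_coeff (2 * i)) (s ^ i))"
  have deg: "degree (s ^ i) \<le> 2 * i" for i
    by (rule order_trans[OF degree_power_le]) (simp add: s_def)
  have "degree q \<le> d"
    unfolding q_def d
    by (intro degree_sum_le order_trans[OF degree_smult_le] order_trans[OF deg]) auto
  moreover have "coeff q d = section_eigenvalue d"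
  proof -
    have "coeff (s ^ i) d = (if i = j then (- 1) ^ j else 0)" if "i \<le> j" for i
    proof (cases "i = j")
      case True
      have ds: "degree s = 2" "lead_coeff s = - 1" by (simp_all add: s_def)
      have "degree (s ^ j) = d" by (simp add: degree_power_eq ds d s_def)
      thus ?thesis using True ds(2) lead_coeff_power[of s j] by simp
    next
      case False
      hence "degree (s ^ i) < d" using deg[of i] that d by linarith
      thus ?thesis using False by (simp add: coeff_eq_0)
    qed
    hence "coeff q d = (\<Sum>i\<le>j. if i = j then section_moment d * b i * transfer_coeff (2 * i) * (- 1) ^ j else 0)"
      unfolding q_def coeff_sum by (intro sum.cong) auto
    also have "\<dots> = section_moment d * transfer_coeff d * ((-1) ^ j * (-1) ^ j)"
      by (simp add: b_def d)
    finally show ?thesis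
      by (simp add: section_eigenvalue_def flip: power_mult_distrib)
  qed
  moreover have "section_adjoint (\<lambda>x. (a \<bullet> x) ^ d) (\<lambda>x. poly q (a \<bullet> x))"
    unfolding section_adjoint_def
  proof (intro allI impI)
    fix D and g :: "'a \<Rightarrow> real" assume g: "ridge_poly D g"
    have binom: "(1 - t) ^ j = (\<Sum>i\<le>j. b i * t ^ i)" for t :: real
      using binomial_ring[of "- t" 1 j] by (simp add: b_def power_minus[of t] mult_ac)
    let ?\<phi> = "\<lambda>\<omega> i. norm (a - closest_point (H \<omega>) a) ^ (2 * i)"
    have "section_mean (\<lambda>x. (a \<bullet> x) ^ d) \<omega> = section_moment d * (\<Sum>i\<le>j. b i * ?\<phi> \<omega> i)"
      if om: "\<omega> \<in> space M" for \<omega>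
    proof -
      have "(norm (closest_point (H \<omega>) a))\<^sup>2 = 1 - (norm (a - closest_point (H \<omega>) a))\<^sup>2"
        unfolding closest_point_subspace_inner(4)[OF H_subspace[OF om]] using a by simp
      hence "norm (closest_point (H \<omega>) a) ^ d = (\<Sum>i\<le>j. b i * ?\<phi> \<omega> i)"
        unfolding d power_mult binom[symmetric] by simp
      thus ?thesis by (simp add: section_mean_inner_power[OF om])
    qed
    hence "expectation (\<lambda>\<omega>. section_mean (\<lambda>x. (a \<bullet> x) ^ d) \<omega> * section_mean g \<omega>) =
        expectation (\<lambda>\<omega>. \<Sum>i\<le>j. section_moment d * b i * (?\<phi> \<omega> i * section_mean g \<omega>))"
      by (intro Bochner_Integration.integral_cong refl)
        (simp add: sum_distrib_left sum_distrib_right mult_ac)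
    also have "\<dots> = (\<Sum>i\<le>j. section_moment d * b i * expectation (\<lambda>\<omega>. ?\<phi> \<omega> i * section_mean g \<omega>))"
      using norm_coproj_le[OF _ a]
      by (subst Bochner_Integration.integral_sum)
        (auto intro!: integrable_section_mean_mult[OF _ _ g, of _ 1] power_le_one)
    also have "\<dots> = (\<Sum>i\<le>j. section_moment d * b i *
        (transfer_coeff (2 * i) * (\<integral>y. norm (orth_part y a) ^ (2 * i) * g y \<partial>\<sigma>)))"
      using section_mean_transfer[OF g a] by simp
    also have "\<dots> = (\<Sum>i\<le>j. (\<integral>y. section_moment d * b i *
        transfer_coeff (2 * i) * norm (orth_part y a) ^ (2 * i) * g y \<partial>\<sigma>))"
      by (simp add: mult.assoc)
    also have "\<dots> = (\<integral>y. (\<Sum>i\<le>j. section_moment d * b i *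
        transfer_coeff (2 * i) * norm (orth_part y a) ^ (2 * i) * g y) \<partial>\<sigma>)"
      by (intro Bochner_Integration.integral_sum[symmetric] integrable_sphere_mult continuous_intros
          continuous_on_orth_part_norm ridge_poly_continuous[OF g])
    also have "\<dots> = (\<integral>y. poly q (a \<bullet> y) * g y \<partial>\<sigma>)"
    proof (intro Bochner_Integration.integral_cong refl)
      fix y assume "y \<in> space \<sigma>"
      hence y: "norm y = 1" by (rule norm_sphere[OF sphere])
      show "(\<Sum>i\<le>j. section_moment d * b i *
          transfer_coeff (2 * i) * norm (orth_part y a) ^ (2 * i) * g y) = poly q (a \<bullet> y) * g y"
        by (simp add: q_def s_def poly_sum norm_orth_part_even_power[OF y a] sum_distrib_right
            poly_power power2_eq_square)
    qed
    finally show "expectation (\<lambda>\<omega>. section_mean (\<lambda>x. (a \<bullet> x) ^ d) \<omega> * section_mean g \<omega>) =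
      (\<integral>y. poly q (a \<bullet> y) * g y \<partial>\<sigma>)" .
  qed
  ultimately show ?thesis by blast
qed

text \<open>A single scalar for the whole filtration step makes the claim linear in
  \<open>f\<close>, so that it passes to sums and multiples.\<close>

lemma section_adjoint_triangular:
  assumes "ridge_poly (Suc D) f"
  shows "\<exists>g. ridge_poly D g \<and> section_adjoint f (\<lambda>x. section_eigenvalue (Suc D) * f x + g x)"
  using assms
proof (induction rule: ridge_poly.induct)
  case (ridge_power d a)
  obtain q where q: "degree q \<le> d" "coeff q d = section_eigenvalue d"
      "section_adjoint (\<lambda>x. (a \<bullet> x) ^ d) (\<lambda>x. poly q (a \<bullet> x))"
    using section_adjoint_ridge_power[OF ridge_power(2)] by blast
  \<comment> \<open>The eigenvalue of degree \<open>Suc D\<close> is subtracted whatever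
    \<open>d\<close> is: for \<open>d = Suc D\<close> this cancels the top coefficient, and for
    smaller \<open>d\<close> the correction has degree at most \<open>D\<close> anyway.\<close>
  let ?p = "q - monom (section_eigenvalue (Suc D)) d"
  have eq: "section_eigenvalue (Suc D) * (a \<bullet> x) ^ d + poly ?p (a \<bullet> x) = poly q (a \<bullet> x)" for x
    by (simp add: poly_monom)
  have "ridge_poly D (\<lambda>x. poly ?p (a \<bullet> x))"
  proof (rule ridge_poly_poly[OF _ ridge_power(2)])
    show "degree ?p \<le> D"
    proof (rule degree_le, intro allI impI)
      fix i assume "D < i"
      show "coeff ?p i = 0"
      proof (cases "i = d")
        case True
        with \<open>D < i\<close> ridge_power(1) have "d = Suc D" by simp
        thus ?thesis using True q(2) by simp
      next
        case False
        hence "i > d" using \<open>D < i\<close> ridge_power(1) by simp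
        thus ?thesis using q(1) by (simp add: coeff_eq_0)
      qed
    qed
  qed
  moreover have "section_adjoint (\<lambda>x. (a \<bullet> x) ^ d)
      (\<lambda>x. section_eigenvalue (Suc D) * (a \<bullet> x) ^ d + poly ?p (a \<bullet> x))"
    unfolding eq by (rule q(3))
  ultimately show ?case by blast
next
  case (ridge_add f f')
  then obtain g g' where g: "ridge_poly D g" "ridge_poly D g'"
    "section_adjoint f (\<lambda>x. section_eigenvalue (Suc D) * f x + g x)"
    "section_adjoint f' (\<lambda>x. section_eigenvalue (Suc D) * f' x + g' x)" by blast
  have "section_adjoint (\<lambda>x. f x + f' x)
    (\<lambda>x. (section_eigenvalue (Suc D) * f x + g x) + (section_eigenvalue (Suc D) * f' x + g' x))"
    using g ridge_add(1,2)
    by (intro section_adjoint_add[where D = "Suc D"])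
      (auto intro!: ridge_poly.ridge_add ridge_mult intro: ridge_poly_mono[of D])
  thus ?case
    using g by (intro exI[of _ "\<lambda>x. g x + g' x"]) (auto intro: ridge_poly.ridge_add simp: algebra_simps)
next
  case (ridge_mult f c)
  then obtain g where g: "ridge_poly D g"
    "section_adjoint f (\<lambda>x. section_eigenvalue (Suc D) * f x + g x)" by blast
  have "section_adjoint (\<lambda>x. c * f x) (\<lambda>x. c * (section_eigenvalue (Suc D) * f x + g x))"
    by (rule section_adjoint_mult[OF g(2)])
  thus ?case
    using g by (intro exI[of _ "\<lambda>x. c * g x"]) (auto intro: ridge_poly.ridge_mult simp: algebra_simps)
qed

section \<open>Growth of the iterates\<close>

lemma square_sum_le:
  fixes x y \<epsilon> :: real
  assumes "\<epsilon> > 0"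
  shows "(x + y)\<^sup>2 \<le> (1 + \<epsilon>) * x\<^sup>2 + (1 + 1 / \<epsilon>) * y\<^sup>2"
proof -
  have "0 \<le> (\<epsilon> * x - y)\<^sup>2 / \<epsilon>" using assms by simp
  also have "\<dots> = \<epsilon> * x\<^sup>2 - 2 * x * y + y\<^sup>2 / \<epsilon>"
    using assms by (simp add: power2_eq_square field_simps)
  finally show ?thesis by (simp add: power2_sum algebra_simps)
qed

lemma integrable_ridge_square: "ridge_poly D f \<Longrightarrow> integrable \<sigma> (\<lambda>x. (f x)\<^sup>2)"
  by (intro integrable_rotation_invariant_continuous[OF sphere] continuous_intros ridge_poly_continuous)

text \<open>Triangularity lets the iterates be built and estimated by induction on the degree,
  without a norm bound on the operator. The slack \<open>s > spectral_bound\<^sup>2\<close> absorbs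
  the polynomial factors that a triangular operator may produce; centring excludes nonzero
  constants, which the operator fixes.\<close>

lemma section_adjoint_iterates:
  assumes "ridge_poly D f" "(\<integral>x. f x \<partial>\<sigma>) = 0" "s > spectral_bound\<^sup>2"
  shows "\<exists>F B. F 0 = f \<and> (\<forall>m. ridge_poly D (F m) \<and> section_adjoint (F m) (F (Suc m)) \<and>
    (\<integral>x. (F m x)\<^sup>2 \<partial>\<sigma>) \<le> B * s ^ m)"
  using assms(1,2)
proof (induction D arbitrary: f)
  case 0
  then obtain c where "f = (\<lambda>_. c)" using ridge_poly_0 by blast
  with 0 have f: "f = (\<lambda>_. 0)" by (simp add: sphere.prob_space)
  show ?case
    by (intro exI[of _ "\<lambda>_ _. 0"] exI[of _ 0])
      (auto simp: f ridge_poly_const section_adjoint_def section_mean_def)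
next
  case (Suc D)
  let ?l = "section_eigenvalue (Suc D)"
  obtain g where g: "ridge_poly D g" "section_adjoint f (\<lambda>x. ?l * f x + g x)"
    using section_adjoint_triangular[OF Suc.prems(1)] by blast
  \<comment> \<open>Testing against 1 shows that the operator preserves the mean; hence
    \<open>g\<close> is centred and the induction hypothesis applies.\<close>
  have "(\<integral>x. ?l * f x + g x \<partial>\<sigma>) = 0"
    using g(2)[unfolded section_adjoint_def, rule_format, OF ridge_poly_const[of 0 1]]
      expectation_section_mean_ridge[OF Suc.prems(1)] Suc.prems(2)
    by (simp add: section_mean_const cong: Bochner_Integration.integral_cong)
  moreover have "(\<integral>x. ?l * f x + g x \<partial>\<sigma>) = ?l * (\<integral>x. f x \<partial>\<sigma>) + (\<integral>x. g x \<partial>\<sigma>)"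
    using integrable_rotation_invariant_continuous[OF sphere ridge_poly_continuous[OF g(1)]]
      integrable_rotation_invariant_continuous[OF sphere ridge_poly_continuous[OF Suc.prems(1)]]
    by simp
  ultimately have "(\<integral>x. g x \<partial>\<sigma>) = 0" using Suc.prems(2) by simp
  from Suc.IH[OF g(1) this] obtain G B where G: "G 0 = g" "\<And>m. ridge_poly D (G m)"
    "\<And>m. section_adjoint (G m) (G (Suc m))" "\<And>m. (\<integral>x. (G m x)\<^sup>2 \<partial>\<sigma>) \<le> B * s ^ m" by blast
  \<comment> \<open>\<open>G m\<close> is the \<open>m\<close>-th iterate of \<open>g\<close>. Since
    the first image of \<open>f\<close> is \<open>?l\<close> times \<open>f\<close> plus
    \<open>g\<close>, linearity forces this recursion on the iterates of \<open>f\<close>.\<close>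
  define F where "F = rec_nat f (\<lambda>m h x. ?l * h x + G m x)"
  have F0: "F 0 = f" and FS: "F (Suc m) = (\<lambda>x. ?l * F m x + G m x)" for m
    by (simp_all add: F_def)
  have rF: "ridge_poly (Suc D) (F m)" for m
  proof (induction m)
    case (Suc m)
    thus ?case unfolding FS by (intro ridge_add ridge_mult ridge_poly_mono[OF G(2)]) simp_all
  qed (simp add: F0 Suc.prems)
  have aF: "section_adjoint (F m) (F (Suc m))" for m
  proof (induction m)
    case 0
    show ?case using g(2) by (simp add: FS F0 G(1))
  next
    case (Suc m)
    have "section_adjoint (\<lambda>x. ?l * F m x + G m x) (\<lambda>x. ?l * F (Suc m) x + G (Suc m) x)"
      by (intro section_adjoint_add[where D = "Suc D"] section_adjoint_mult Suc G(3) ridge_mult rF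
          ridge_poly_mono[OF G(2)]) simp_all
    thus ?case unfolding FS .
  qed
  have c0: "spectral_bound > 0" by (rule spectral_bound_pos)
  \<comment> \<open>The weight in \<open>square_sum_le\<close> that makes
    \<open>(1 + \<epsilon>) * spectral_bound\<^sup>2\<close> the midpoint \<open>s0\<close> of
    \<open>spectral_bound\<^sup>2\<close> and \<open>s\<close>.\<close>
  define \<epsilon> where "\<epsilon> = (s - spectral_bound\<^sup>2) / (2 * spectral_bound\<^sup>2)"
  define s0 where "s0 = (s + spectral_bound\<^sup>2) / 2"
  have \<epsilon>: "\<epsilon> > 0" using assms(3) c0 by (simp add: \<epsilon>_def)
  have s0: "s0 < s" "(1 + \<epsilon>) * spectral_bound\<^sup>2 = s0" "s0 > 0"
  proof -
    have c2: "spectral_bound\<^sup>2 > 0" using c0 by simp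
    show "s0 > 0"
      unfolding s0_def by (intro half_gt_zero add_pos_pos order_less_trans[OF c2 assms(3)] c2)
    have "(s + x) / 2 < s" if "x < s" for x using that by simp
    from this[OF assms(3)] show "s0 < s" unfolding s0_def .
    show "(1 + \<epsilon>) * spectral_bound\<^sup>2 = s0"
      using c0 by (simp add: s0_def \<epsilon>_def field_simps)
  qed
  have spos: "s > 0" using s0 by simp
  have l: "?l\<^sup>2 \<le> spectral_bound\<^sup>2"
    using section_eigenvalue_bounds[of "Suc D"] by (intro power_mono) auto
  \<comment> \<open>The squared norms \<open>a m\<close> satisfy
    \<open>a (Suc m) \<le> s0 * a m + K * s ^ m\<close> in the worst case. \<open>C\<close> is large
    enough to start the induction and to give \<open>s0 * C + K \<le> C * s\<close>.\<close>
  define K where "K = (1 + 1 / \<epsilon>) * B"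
  define C where "C = max (\<integral>x. (f x)\<^sup>2 \<partial>\<sigma>) (K / (s - s0))"
  have C0: "C \<ge> 0"
    unfolding C_def le_max_iff_disj by (intro disjI1 Bochner_Integration.integral_nonneg) simp
  have KC: "K \<le> C * (s - s0)"
    using s0 by (simp add: C_def pos_divide_le_eq[symmetric])
  have bF: "(\<integral>x. (F m x)\<^sup>2 \<partial>\<sigma>) \<le> C * s ^ m" for m
  proof (induction m)
    case 0
    show ?case by (simp add: F0 C_def)
  next
    case (Suc m)
    have "(\<integral>x. (F (Suc m) x)\<^sup>2 \<partial>\<sigma>) \<le> (\<integral>x. (1 + \<epsilon>) * ?l\<^sup>2 * (F m x)\<^sup>2 + (1 + 1 / \<epsilon>) * (G m x)\<^sup>2 \<partial>\<sigma>)"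
    proof (rule integral_mono)
      show "integrable \<sigma> (\<lambda>x. (F (Suc m) x)\<^sup>2)" by (rule integrable_ridge_square[OF rF])
      show "integrable \<sigma> (\<lambda>x. (1 + \<epsilon>) * ?l\<^sup>2 * (F m x)\<^sup>2 + (1 + 1 / \<epsilon>) * (G m x)\<^sup>2)"
        using integrable_ridge_square[OF rF[of m]] integrable_ridge_square[OF G(2)[of m]] by simp
      show "(F (Suc m) x)\<^sup>2 \<le> (1 + \<epsilon>) * ?l\<^sup>2 * (F m x)\<^sup>2 + (1 + 1 / \<epsilon>) * (G m x)\<^sup>2" for x
        unfolding FS using square_sum_le[OF \<epsilon>, of "?l * F m x" "G m x"] by (simp add: power_mult_distrib mult.assoc)
    qed
    also have "\<dots> = (1 + \<epsilon>) * ?l\<^sup>2 * (\<integral>x. (F m x)\<^sup>2 \<partial>\<sigma>) + (1 + 1 / \<epsilon>) * (\<integral>x. (G m x)\<^sup>2 \<partial>\<sigma>)"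
      using integrable_ridge_square[OF rF[of m]] integrable_ridge_square[OF G(2)[of m]] by simp
    also have "\<dots> \<le> s0 * (C * s ^ m) + (1 + 1 / \<epsilon>) * (B * s ^ m)"
    proof (intro add_mono mult_mono)
      show "(1 + \<epsilon>) * ?l\<^sup>2 \<le> s0" unfolding s0(2)[symmetric] using l \<epsilon> by (intro mult_left_mono) auto
    qed (use Suc G(4) s0 \<epsilon> in auto)
    also have "\<dots> = (s0 * C + K) * s ^ m" by (simp add: K_def algebra_simps)
    also have "\<dots> \<le> (s0 * C + C * (s - s0)) * s ^ m"
      using KC spos by (intro mult_right_mono) auto
    also have "\<dots> = C * s ^ Suc m" by (simp add: algebra_simps)
    finally show ?case .
  qed
  show ?case
    using F0 rF aF bF by blast
qed

section \<open>From the growth rate to the norm bound\<close>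

lemma section_adjoint_symmetric:
  assumes "section_adjoint f h" "section_adjoint h h'" "ridge_poly D f" "ridge_poly D h"
  shows "(\<integral>x. (h x)\<^sup>2 \<partial>\<sigma>) = (\<integral>x. f x * h' x \<partial>\<sigma>)"
proof -
  have "(\<integral>x. h x * h x \<partial>\<sigma>) = expectation (\<lambda>\<omega>. section_mean f \<omega> * section_mean h \<omega>)"
    using assms by (auto simp: section_adjoint_def)
  also have "\<dots> = (\<integral>x. h' x * f x \<partial>\<sigma>)"
    using assms by (auto simp: section_adjoint_def mult.commute)
  finally show ?thesis by (simp add: power2_eq_square mult.commute)
qed

text \<open>A weighted substitute for Cauchy-Schwarz: the free weight \<open>t\<close> replaces
  square roots.\<close>

lemma integral_two_mult_le:
  assumes "ridge_poly D f" "ridge_poly D g" "t > 0"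
  shows "2 * (\<integral>x. f x * g x \<partial>\<sigma>) \<le> t * (\<integral>x. (f x)\<^sup>2 \<partial>\<sigma>) + (\<integral>x. (g x)\<^sup>2 \<partial>\<sigma>) / t"
proof -
  note int = integrable_ridge_square[OF assms(1)] integrable_ridge_square[OF assms(2)]
    integrable_sphere_mult[OF ridge_poly_continuous[OF assms(1)] ridge_poly_continuous[OF assms(2)]]
  have "(\<integral>x. 2 * (f x * g x) \<partial>\<sigma>) \<le> (\<integral>x. t * (f x)\<^sup>2 + (g x)\<^sup>2 / t \<partial>\<sigma>)"
  proof (rule integral_mono)
    show "2 * (f x * g x) \<le> t * (f x)\<^sup>2 + (g x)\<^sup>2 / t" for x
    proof -
      have "0 \<le> (t * f x - g x)\<^sup>2 / t" using assms(3) by simp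
      also have "\<dots> = t * (f x)\<^sup>2 - 2 * (f x * g x) + (g x)\<^sup>2 / t"
        using assms(3) by (simp add: power2_eq_square field_simps)
      finally show ?thesis by simp
    qed
  qed (use int in auto)
  thus ?thesis using int by simp
qed

text \<open>
  The sequence \<open>a m = \<parallel>(T* T)^m f\<parallel>\<^sup>2\<close> is log-convex because \<open>T* T\<close> is symmetric, so its first
  ratio is at most its exponential growth rate.
\<close>

lemma section_mean_contraction_centered:
  assumes f: "ridge_poly D f" "(\<integral>x. f x \<partial>\<sigma>) = 0"
  shows "expectation (\<lambda>\<omega>. (section_mean f \<omega>)\<^sup>2) \<le> spectral_bound * (\<integral>x. (f x)\<^sup>2 \<partial>\<sigma>)"
proof -
  let ?c = spectral_bound
  have c: "?c > 0" by (rule spectral_bound_pos)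
  have main: "(\<integral>x. (h x)\<^sup>2 \<partial>\<sigma>) \<le> ?c\<^sup>2 * (\<integral>x. (f x)\<^sup>2 \<partial>\<sigma>)" if h: "section_adjoint f h" "ridge_poly D h" for h
  proof (rule ccontr)
    assume neg: "\<not> ?thesis"
    let ?a0 = "\<integral>x. (f x)\<^sup>2 \<partial>\<sigma>" and ?a1 = "\<integral>x. (h x)\<^sup>2 \<partial>\<sigma>"
    have a0: "?a0 \<ge> 0" by (intro Bochner_Integration.integral_nonneg) simp
    \<comment> \<open>A ratio above the claimed bound; if the squared norm of \<open>f\<close> is 0,
      any \<open>r\<close> above \<open>?c\<^sup>2\<close> will do.\<close>
    obtain r where r: "r > ?c\<^sup>2" "r * ?a0 \<le> ?a1"
    proof (cases "?a0 = 0")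
      case True
      thus ?thesis using neg by (intro that[of "?c\<^sup>2 + 1"]) auto
    next
      case False
      hence pos: "?a0 > 0" using a0 by linarith
      have "?c\<^sup>2 < ?a1 / ?a0"
        unfolding pos_less_divide_eq[OF pos] using neg by linarith
      thus ?thesis using False by (intro that[of "?a1 / ?a0"]) simp_all
    qed
    define s where "s = (r + ?c\<^sup>2) / 2"
    have s: "s > ?c\<^sup>2" "s < r" using r by (auto simp: s_def)
    have s0: "s > 0" using s c by (meson less_trans zero_less_power)
    obtain F B where F: "F 0 = f" "\<And>m. ridge_poly D (F m)"
        "\<And>m. section_adjoint (F m) (F (Suc m))" "\<And>m. (\<integral>x. (F m x)\<^sup>2 \<partial>\<sigma>) \<le> B * s ^ m"
      using section_adjoint_iterates[OF f s(1)] by blast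
    define a where "a m = (\<integral>x. (F m x)\<^sup>2 \<partial>\<sigma>)" for m
    have a_nn: "a m \<ge> 0" for m unfolding a_def by (intro Bochner_Integration.integral_nonneg) simp
    \<comment> \<open>\<open>F 1\<close> and \<open>h\<close> both represent the image of
      \<open>f\<close>, so they have the same pairing with \<open>h\<close>, and the norm of
      \<open>F 1\<close> is at least that of \<open>h\<close>.\<close>
    have "(\<integral>x. F 1 x * h x \<partial>\<sigma>) = expectation (\<lambda>\<omega>. section_mean f \<omega> * section_mean h \<omega>)"
      using F(3)[of 0] h(2) by (auto simp: F(1) section_adjoint_def)
    also have "\<dots> = ?a1" using h by (auto simp: section_adjoint_def power2_eq_square)
    finally have "2 * ?a1 \<le> a 1 + ?a1"
      using integral_two_mult_le[OF F(2)[of 1] h(2), of 1] by (simp add: a_def)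
    hence a1: "a 1 \<ge> ?a1" by simp
    have r0: "r > 0" using s s0 by simp
    \<comment> \<open>Log-convexity with weight \<open>r\<close>: the lower bound on one ratio is
      carried to the next.\<close>
    have ratio: "a (Suc m) \<ge> r * a m" for m
    proof (induction m)
      case 0
      show ?case using a1 r(2) by (simp add: a_def F(1))
    next
      case (Suc m)
      have "a (Suc m) = (\<integral>x. F m x * F (Suc (Suc m)) x \<partial>\<sigma>)"
        unfolding a_def by (rule section_adjoint_symmetric[OF F(3) F(3) F(2) F(2)])
      hence "2 * a (Suc m) \<le> r * a m + a (Suc (Suc m)) / r"
        using integral_two_mult_le[OF F(2)[of m] F(2)[of "Suc (Suc m)"] r0] by (simp add: a_def)
      hence "a (Suc m) \<le> a (Suc (Suc m)) / r" using Suc by linarith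
      thus ?case using r0 by (simp add: field_simps)
    qed
    have growth: "a (Suc m) \<ge> r ^ m * a 1" for m
    proof (induction m)
      case (Suc m)
      have "r ^ Suc m * a 1 \<le> r * a (Suc m)" using Suc r0 by (simp add: mult.assoc)
      also have "\<dots> \<le> a (Suc (Suc m))" by (rule ratio)
      finally show ?case .
    qed simp
    have "a 1 > 0"
      using neg a1 a0 c by (smt (verit) mult_nonneg_nonneg zero_le_power2)
    \<comment> \<open>The iterates would grow at rate at least \<open>r\<close>, against the bound
      of rate \<open>s < r\<close>.\<close>
    have bound: "(r / s) ^ m \<le> B * s / a 1" for m
    proof -
      have "r ^ m * a 1 \<le> B * s * s ^ m"
        using growth[of m] F(4)[of "Suc m"] by (simp add: a_def mult.assoc)
      thus ?thesis using \<open>a 1 > 0\<close> s0 by (simp add: power_divide field_simps)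
    qed
    have "r / s > 1" using s s0 by simp
    then obtain m where "(r / s) ^ m > B * s / a 1" using real_arch_pow by blast
    thus False using bound[of m] by simp
  qed
  \<comment> \<open>Any admissible rate will do: only a representative of the image of
    \<open>f\<close> is wanted.\<close>
  obtain F B where F: "F 0 = f" "\<And>m. ridge_poly D (F m)" "\<And>m. section_adjoint (F m) (F (Suc m))"
      "\<And>m. (\<integral>x. (F m x)\<^sup>2 \<partial>\<sigma>) \<le> B * (?c\<^sup>2 + 1) ^ m"
    using section_adjoint_iterates[OF f, of "?c\<^sup>2 + 1"] by auto
  let ?h = "F (Suc 0)"
  have h: "section_adjoint f ?h" using F(3)[of 0] by (simp add: F(1))
  have "expectation (\<lambda>\<omega>. (section_mean f \<omega>)\<^sup>2) = (\<integral>x. f x * ?h x \<partial>\<sigma>)"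
    using h f(1) by (auto simp: section_adjoint_def power2_eq_square mult.commute)
  \<comment> \<open>The weight \<open>?c\<close> balances the terms: by \<open>main\<close> the
    second is at most as large as the first.\<close>
  also have "2 * \<dots> \<le> ?c * (\<integral>x. (f x)\<^sup>2 \<partial>\<sigma>) + (\<integral>x. (?h x)\<^sup>2 \<partial>\<sigma>) / ?c"
    by (rule integral_two_mult_le[OF f(1) F(2) c])
  also have "\<dots> \<le> ?c * (\<integral>x. (f x)\<^sup>2 \<partial>\<sigma>) + ?c * (\<integral>x. (f x)\<^sup>2 \<partial>\<sigma>)"
    using main[OF h F(2)] c by (simp add: field_simps power2_eq_square)
  finally show ?thesis by simp
qed

text \<open>Centring subtracts the squared mean from both second moments, because
  \<open>section_mean\<close> preserves constants and means.\<close>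

lemma section_mean_variance_ridge:
  assumes f: "ridge_poly D f"
  shows "expectation (\<lambda>\<omega>. (section_mean f \<omega>)\<^sup>2) - (\<integral>x. f x \<partial>\<sigma>)\<^sup>2
    \<le> spectral_bound * ((\<integral>x. (f x)\<^sup>2 \<partial>\<sigma>) - (\<integral>x. f x \<partial>\<sigma>)\<^sup>2)"
proof -
  define m where "m = (\<integral>x. f x \<partial>\<sigma>)"
  let ?g = "\<lambda>x. f x + (- m)"
  have g: "ridge_poly D ?g" by (intro ridge_add f ridge_poly_const)
  have int: "integrable \<sigma> f"
    by (intro integrable_rotation_invariant_continuous[OF sphere] ridge_poly_continuous[OF f])
  have intT: "integrable M (section_mean f)"
    using integrable_section_mean_product[OF f ridge_poly_const[of 0 1]]
    by (simp add: section_mean_const cong: Bochner_Integration.integrable_cong)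
  have intT2: "integrable M (\<lambda>\<omega>. (section_mean f \<omega>)\<^sup>2)"
    using integrable_section_mean_product[OF f f] by (simp add: power2_eq_square)
  have "(\<integral>x. ?g x \<partial>\<sigma>) = 0" using int by (simp add: m_def sphere.prob_space)
  from section_mean_contraction_centered[OF g this]
  have "expectation (\<lambda>\<omega>. (section_mean ?g \<omega>)\<^sup>2) \<le> spectral_bound * (\<integral>x. (?g x)\<^sup>2 \<partial>\<sigma>)" .
  also have "expectation (\<lambda>\<omega>. (section_mean ?g \<omega>)\<^sup>2) =
      expectation (\<lambda>\<omega>. (section_mean f \<omega>)\<^sup>2 - 2 * m * section_mean f \<omega> + m\<^sup>2)"
  proof (intro Bochner_Integration.integral_cong refl)
    fix \<omega> assume om: "\<omega> \<in> space M"
    have "section_mean ?g \<omega> = section_mean f \<omega> - m"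
      using section_mean_add[OF om ridge_poly_continuous[OF f], of "\<lambda>_. - m"] section_mean_const[OF om]
      by simp
    thus "(section_mean ?g \<omega>)\<^sup>2 = (section_mean f \<omega>)\<^sup>2 - 2 * m * section_mean f \<omega> + m\<^sup>2"
      by (simp only: power2_diff) simp
  qed
  also have "\<dots> = expectation (\<lambda>\<omega>. (section_mean f \<omega>)\<^sup>2) - m\<^sup>2"
    using intT intT2 expectation_section_mean_ridge[OF f]
    by (simp add: prob_space m_def[symmetric] power2_eq_square)
  also have "(\<integral>x. (?g x)\<^sup>2 \<partial>\<sigma>) = (\<integral>x. (f x)\<^sup>2 - 2 * m * f x + m\<^sup>2 \<partial>\<sigma>)"
    by (intro Bochner_Integration.integral_cong refl) (simp add: power2_diff)
  also have "\<dots> = (\<integral>x. (f x)\<^sup>2 \<partial>\<sigma>) - m\<^sup>2"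
    using int integrable_ridge_square[OF f]
    by (simp add: sphere.prob_space m_def[symmetric] power2_eq_square)
  finally show ?thesis by (simp add: m_def)
qed

end

subsection \<open>Uniform approximation by ridge polynomials\<close>

text \<open>Exponentials of linear forms are closed under products, as Stone-Weierstrass demands,
  which is not evident for ridge polynomials.\<close>

inductive exp_sum :: "('a::euclidean_space \<Rightarrow> real) \<Rightarrow> bool" where
  exp_sum_exp: "exp_sum (\<lambda>x. exp (a \<bullet> x))"
| exp_sum_add: "exp_sum f \<Longrightarrow> exp_sum g \<Longrightarrow> exp_sum (\<lambda>x. f x + g x)"
| exp_sum_scale: "exp_sum f \<Longrightarrow> exp_sum (\<lambda>x. c * f x)"

lemma exp_sum_continuous: "exp_sum f \<Longrightarrow> continuous_on S f"
  by (induction rule: exp_sum.induct) (intro continuous_intros; assumption)+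

lemma exp_sum_mult:
  assumes "exp_sum f" "exp_sum g"
  shows "exp_sum (\<lambda>x. f x * g x)"
  using assms(1)
proof (induction rule: exp_sum.induct)
  case (exp_sum_exp a)
  show ?case
    using assms(2)
  proof (induction rule: exp_sum.induct)
    case (exp_sum_exp b)
    show ?case
      using exp_sum.exp_sum_exp[of "a + b"] by (simp add: inner_add_left exp_add)
  next
    case (exp_sum_add f g)
    thus ?case using exp_sum.exp_sum_add by (simp add: distrib_left)
  next
    case (exp_sum_scale f c)
    thus ?case using exp_sum.exp_sum_scale[of _ c] by (simp add: mult.left_commute)
  qed
next
  case (exp_sum_add f g)
  thus ?case using exp_sum.exp_sum_add by (simp add: distrib_right)
next
  case (exp_sum_scale f c)
  thus ?case using exp_sum.exp_sum_scale[of _ c] by (simp add: mult.assoc)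
qed

lemma ridge_poly_inner_power: "ridge_poly d (\<lambda>x. (a \<bullet> x) ^ d)"
proof (cases "a = 0")
  case True
  thus ?thesis using ridge_poly_const by simp
next
  case False
  have "ridge_poly d (\<lambda>x. norm a ^ d * ((a /\<^sub>R norm a) \<bullet> x) ^ d)"
    using False by (intro ridge_mult ridge_power) simp_all
  also have "(\<lambda>x. norm a ^ d * ((a /\<^sub>R norm a) \<bullet> x) ^ d) = (\<lambda>x. (a \<bullet> x) ^ d)"
    using False by (simp add: fun_eq_iff mult.assoc[symmetric] flip: power_mult_distrib)
  finally show ?thesis .
qed

text \<open>On the sphere \<open>a \<bullet> x\<close> stays in a compact interval, where the
  exponential series converges uniformly.\<close>

lemma exp_sum_ridge_approx:
  assumes "exp_sum f" "e > 0"
  shows "\<exists>D g. ridge_poly D g \<and> (\<forall>x\<in>sphere 0 1. \<bar>f x - g x\<bar> < e)"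
  using assms
proof (induction arbitrary: e rule: exp_sum.induct)
  case (exp_sum_exp a)
  have "uniform_limit {- norm a..norm a} (\<lambda>n x. \<Sum>i<n. x ^ i /\<^sub>R fact i) (\<lambda>x. \<Sum>i. x ^ i /\<^sub>R fact i) sequentially"
  proof (rule Weierstrass_m_test)
    show "norm (x ^ n /\<^sub>R fact n) \<le> norm a ^ n /\<^sub>R fact n" if "x \<in> {- norm a..norm a}" for n x
      using that by (auto simp: power_abs abs_mult intro!: mult_left_mono power_mono)
    show "summable (\<lambda>n. norm a ^ n /\<^sub>R fact n)" by (rule summable_exp_generic)
  qed
  hence "uniform_limit {- norm a..norm a} (\<lambda>n x. \<Sum>i<n. x ^ i /\<^sub>R fact i) exp sequentially"
    by (simp add: exp_def)
  then obtain N where N: "\<And>x. x \<in> {- norm a..norm a} \<Longrightarrow> dist (\<Sum>i<N. x ^ i /\<^sub>R fact i) (exp x) < e"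
    using exp_sum_exp by (fastforce simp: uniform_limit_iff eventually_sequentially)
  have "ridge_poly N (\<lambda>x. \<Sum>i<N. (1 / fact i) * (a \<bullet> x) ^ i)"
    by (intro ridge_poly_sum ridge_mult ridge_poly_mono[OF ridge_poly_inner_power]) auto
  moreover have "\<bar>exp (a \<bullet> x) - (\<Sum>i<N. (1 / fact i) * (a \<bullet> x) ^ i)\<bar> < e" if "x \<in> sphere 0 1" for x
  proof -
    have "a \<bullet> x \<in> {- norm a..norm a}"
      using Cauchy_Schwarz_ineq2[of a x] that by auto
    from N[OF this] show ?thesis
      by (simp add: dist_real_def abs_minus_commute divide_inverse)
  qed
  ultimately show ?case by blast
next
  case (exp_sum_add f f')
  from exp_sum_add.IH[of "e / 2"] exp_sum_add.prems obtain D g D' g' where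
    g: "ridge_poly D g" "ridge_poly D' g'" "\<And>x. x \<in> sphere 0 1 \<Longrightarrow> \<bar>f x - g x\<bar> < e / 2"
    "\<And>x. x \<in> sphere 0 1 \<Longrightarrow> \<bar>f' x - g' x\<bar> < e / 2" by (metis half_gt_zero)
  have "ridge_poly (max D D') (\<lambda>x. g x + g' x)"
    using g by (intro ridge_add) (auto intro: ridge_poly_mono)
  moreover have "\<bar>f x + f' x - (g x + g' x)\<bar> < e" if "x \<in> sphere 0 1" for x
    using g(3,4)[OF that] by linarith
  ultimately show ?case by blast
next
  case (exp_sum_scale f c)
  \<comment> \<open>Adding 1 covers \<open>c = 0\<close> and makes the final estimate
    strict.\<close>
  have pos: "e / (\<bar>c\<bar> + 1) > 0" using exp_sum_scale.prems by (intro divide_pos_pos) auto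
  from exp_sum_scale.IH[OF this] obtain D g where
    g: "ridge_poly D g" "\<And>x. x \<in> sphere 0 1 \<Longrightarrow> \<bar>f x - g x\<bar> < e / (\<bar>c\<bar> + 1)" by blast
  have "\<bar>c * f x - c * g x\<bar> < e" if "x \<in> sphere 0 1" for x
  proof -
    have "\<bar>c * f x - c * g x\<bar> = \<bar>c\<bar> * \<bar>f x - g x\<bar>"
      by (simp add: abs_mult flip: right_diff_distrib)
    also have "\<dots> \<le> \<bar>c\<bar> * (e / (\<bar>c\<bar> + 1))"
      using g(2)[OF that] by (intro mult_left_mono) auto
    also have "\<dots> < (\<bar>c\<bar> + 1) * (e / (\<bar>c\<bar> + 1))"
      using pos by (intro mult_strict_right_mono) auto
    also have "\<dots> = e" by simp
    finally show ?thesis .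
  qed
  thus ?case using ridge_mult[OF g(1), of c] by blast
qed

lemma continuous_ridge_approx:
  fixes f :: "'a::euclidean_space \<Rightarrow> real"
  assumes "continuous_on UNIV f" "e > 0"
  shows "\<exists>D g. ridge_poly D g \<and> (\<forall>x\<in>sphere 0 1. \<bar>f x - g x\<bar> < e)"
proof -
  have "\<exists>h. exp_sum h \<and> (\<forall>x\<in>sphere 0 1. \<bar>f x - h x\<bar> < e / 2)"
  proof (rule Stone_Weierstrass_HOL)
    show "exp_sum (\<lambda>x::'a. c)" for c
      using exp_sum_scale[OF exp_sum_exp[of 0], of c] by simp
    show "\<exists>h. exp_sum h \<and> h x \<noteq> h y" if xy: "x \<in> sphere 0 1 \<and> y \<in> sphere 0 1 \<and> x \<noteq> y" for x y :: 'a
    proof -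
      \<comment> \<open>\<open>exp (x \<bullet> z)\<close> separates \<open>z = x\<close> from
        \<open>z = y\<close>: equal inner products would force \<open>x - y\<close> to have length
        0.\<close>
      have "x \<bullet> x \<noteq> x \<bullet> y"
      proof
        assume eq: "x \<bullet> x = x \<bullet> y"
        have "(x - y) \<bullet> (x - y) = 0"
          using xy eq by (simp add: inner_diff_left inner_diff_right inner_commute norm_eq_1)
        thus False using xy by simp
      qed
      thus ?thesis using exp_sum_exp[of x] by (intro exI[of _ "\<lambda>z. exp (x \<bullet> z)"]) simp
    qed
  qed (use assms in \<open>auto intro: exp_sum_continuous exp_sum_add exp_sum_mult continuous_on_subset\<close>)
  then obtain h where h: "exp_sum h" "\<And>x. x \<in> sphere 0 1 \<Longrightarrow> \<bar>f x - h x\<bar> < e / 2" by blast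
  obtain D g where g: "ridge_poly D g" "\<And>x. x \<in> sphere 0 1 \<Longrightarrow> \<bar>h x - g x\<bar> < e / 2"
    using exp_sum_ridge_approx[OF h(1), of "e / 2"] assms(2) by auto
  have "\<bar>f x - g x\<bar> < e" if "x \<in> sphere 0 1" for x
    using h(2)[OF that] g(2)[OF that] by linarith
  thus ?thesis using g(1) by blast
qed

subsection \<open>Baire functions\<close>

text \<open>These are limits along which a variance bound survives by dominated convergence.
  Boundedness is asked only on the sphere, where continuous functions have it; convergence
  everywhere keeps the limits Borel on the whole space.\<close>

inductive baire :: "('a::euclidean_space \<Rightarrow> real) \<Rightarrow> bool" where
  baire_continuous: "continuous_on UNIV f \<Longrightarrow> baire f"
| baire_limit: "(\<And>n. baire (f n)) \<Longrightarrow> (\<And>n x. norm x = 1 \<Longrightarrow> \<bar>f n x\<bar> \<le> C) \<Longrightarrow>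
    (\<And>x. (\<lambda>n. f n x) \<longlonglongrightarrow> g x) \<Longrightarrow> baire g"

lemma baire_bounded:
  assumes "baire f"
  shows "\<exists>C\<ge>0. \<forall>x. norm x = 1 \<longrightarrow> \<bar>f x\<bar> \<le> C"
  using assms
proof (induction rule: baire.induct)
  case (baire_continuous f)
  thus ?case using continuous_bounded_on_sphere by metis
next
  case (baire_limit f C g)
  have "\<bar>g x\<bar> \<le> max C 0" if "norm x = 1" for x
    using tendsto_rabs[OF baire_limit.hyps(3)[of x]]
    by (rule LIMSEQ_le_const2) (use baire_limit.hyps(2)[OF that] in \<open>auto simp: le_max_iff_disj\<close>)
  thus ?case by (intro exI[of _ "max C 0"]) auto
qed

text \<open>Induction on \<open>f\<close>, and in its continuous case on \<open>g\<close>; a factor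
  bounded on the sphere preserves limits of this kind.\<close>

lemma baire_mult:
  assumes f: "baire f" and g: "baire g"
  shows "baire (\<lambda>x. f x * g x)"
  using f
proof (induction rule: baire.induct)
  case (baire_continuous f)
  show ?case
    using g
  proof (induction rule: baire.induct)
    case (baire_continuous g)
    thus ?case using \<open>continuous_on UNIV f\<close> by (intro baire.baire_continuous continuous_intros)
  next
    case (baire_limit h C g)
    obtain B where B: "B \<ge> 0" "\<And>x. norm x = 1 \<Longrightarrow> \<bar>f x\<bar> \<le> B"
      using continuous_bounded_on_sphere[OF \<open>continuous_on UNIV f\<close>] by blast
    show ?case
    proof (rule baire.baire_limit)
      show "baire (\<lambda>x. f x * h n x)" for n by (rule baire_limit.IH)
      show "\<bar>f x * h n x\<bar> \<le> B * C" if "norm x = 1" for n x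
        unfolding abs_mult using B that baire_limit.hyps(2)[OF that] by (intro mult_mono) auto
      show "(\<lambda>n. f x * h n x) \<longlonglongrightarrow> f x * g x" for x
        by (intro tendsto_intros baire_limit.hyps)
    qed
  qed
next
  case (baire_limit h C f)
  obtain B where B: "B \<ge> 0" "\<And>x. norm x = 1 \<Longrightarrow> \<bar>g x\<bar> \<le> B"
    using baire_bounded[OF g] by blast
  show ?case
  proof (rule baire.baire_limit)
    show "baire (\<lambda>x. h n x * g x)" for n by (rule baire_limit.IH)
    show "\<bar>h n x * g x\<bar> \<le> C * B" if "norm x = 1" for n x
      unfolding abs_mult using B that baire_limit.hyps(2)[OF that]
      by (intro mult_mono) (auto intro: order_trans[OF abs_ge_zero])
    show "(\<lambda>n. h n x * g x) \<longlonglongrightarrow> f x * g x" for x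
      by (intro tendsto_intros baire_limit.hyps)
  qed
qed

lemma baire_one_minus: "baire f \<Longrightarrow> baire (\<lambda>x. 1 - f x)"
proof (induction rule: baire.induct)
  case (baire_continuous f)
  thus ?case by (intro baire.baire_continuous continuous_intros)
next
  case (baire_limit h C f)
  show ?case
  proof (rule baire.baire_limit)
    show "baire (\<lambda>x. 1 - h n x)" for n by (rule baire_limit.IH)
    show "\<bar>1 - h n x\<bar> \<le> 1 + C" if "norm x = 1" for n x
      using baire_limit.hyps(2)[OF that, of n] by linarith
    show "(\<lambda>n. 1 - h n x) \<longlonglongrightarrow> 1 - f x" for x
      by (intro tendsto_intros baire_limit.hyps)
  qed
qed

text \<open>Multiples of the distance to the complement, cut off at 1, increase to the
  indicator.\<close>

lemma baire_indicator_open: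
  fixes U :: "'a::euclidean_space set"
  assumes "open U"
  shows "baire (indicator U)"
\<comment> \<open>The distance to the empty set is 0 by convention, so the whole space is treated
  apart.\<close>
proof (cases "U = UNIV")
  case True
  thus ?thesis by (intro baire_continuous) (simp add: indicator_def)
next
  case False
  let ?d = "\<lambda>x. infdist x (- U)"
  show ?thesis
  proof (rule baire_limit)
    show "baire (\<lambda>x. min 1 (real n * ?d x))" for n
      by (intro baire_continuous continuous_intros)
    show "\<bar>min 1 (real n * ?d x)\<bar> \<le> 1" for n x
      by (simp add: infdist_nonneg)
    show "(\<lambda>n. min 1 (real n * ?d x)) \<longlonglongrightarrow> indicator U x" for x
    proof (cases "x \<in> U")
      case True
      have "?d x \<noteq> 0"
        using in_closed_iff_infdist_zero[of "- U" x] assms False True by auto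
      hence pos: "?d x > 0" using infdist_nonneg[of x "- U"] by linarith
      have "\<forall>\<^sub>F n in sequentially. min 1 (real n * ?d x) = 1"
      proof (rule eventually_sequentiallyI)
        fix n assume "nat \<lceil>1 / ?d x\<rceil> \<le> n"
        hence "1 / ?d x \<le> real n" by linarith
        thus "min 1 (real n * ?d x) = 1" using pos by (simp add: field_simps)
      qed
      thus ?thesis using True by (simp add: tendsto_eventually)
    next
      case False
      thus ?thesis by simp
    qed
  qed
qed

lemma baire_indicator:
  fixes A :: "'a::euclidean_space set"
  assumes "A \<in> sets borel"
  shows "baire (indicator A)"
proof -
  have compl: "baire (indicator (- A))" if "baire (indicator A)" for A :: "'a set"
  proof -
    have "indicator (- A) = (\<lambda>x. 1 - indicator A x :: real)"
      by (auto simp: indicator_def)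
    thus ?thesis using baire_one_minus[OF that] by simp
  qed
  have inter: "baire (indicator (A \<inter> B))" if "baire (indicator A)" "baire (indicator B)" for A B :: "'a set"
    using baire_mult[OF that] by (simp flip: indicator_inter_arith)
  have "A \<in> sigma_sets UNIV {S. open S}" using assms by (simp add: borel_def)
  thus ?thesis
  proof (induction rule: sigma_sets.induct)
    case (Basic U)
    thus ?case by (simp add: baire_indicator_open)
  next
    case Empty
    show ?case by (rule baire_indicator_open[OF open_empty])
  next
    case (Compl A)
    thus ?case using compl[of A] by (simp add: Compl_eq_Diff_UNIV)
  next
    case (Union A)
    \<comment> \<open>De Morgan gives the finite unions, whose indicators converge to that of the
      countable union.\<close>
    have fin: "baire (indicator (\<Union>i<n. A i))" for n
    proof (induction n)
      case 0
      show ?case by (simp add: baire_continuous)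
    next
      case (Suc n)
      have "(\<Union>i<Suc n. A i) = - (- A n \<inter> - (\<Union>i<n. A i))" by (auto simp: less_Suc_eq)
      thus ?case using compl inter Suc Union by metis
    qed
    show ?case
      by (rule baire_limit[where f = "\<lambda>n. indicator (\<Union>i<n. A i)" and C = 1])
        (rule fin LIMSEQ_indicator_UN | simp)+
  qed
qed

subsection \<open>The variance of random sections\<close>

context random_section
begin

text \<open>Measurability and the mean are bundled with the inequality so that one limit argument
  carries all of them.\<close>

definition section_variance_bound :: "('a \<Rightarrow> real) \<Rightarrow> bool" where
  "section_variance_bound f \<longleftrightarrow> f \<in> borel_measurable borel \<and> section_mean f \<in> borel_measurable M \<and>
    expectation (section_mean f) = (\<integral>x. f x \<partial>\<sigma>) \<and>
    expectation (\<lambda>\<omega>. (section_mean f \<omega>)\<^sup>2) - (\<integral>x. f x \<partial>\<sigma>)\<^sup>2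
      \<le> spectral_bound * ((\<integral>x. (f x)\<^sup>2 \<partial>\<sigma>) - (\<integral>x. f x \<partial>\<sigma>)\<^sup>2)"

lemma section_variance_bound_ridge: "ridge_poly D f \<Longrightarrow> section_variance_bound f"
  unfolding section_variance_bound_def
  using ridge_poly_measurable section_mean_measurable_ridge expectation_section_mean_ridge
    section_mean_variance_ridge by blast

text \<open>Dominated convergence, on the sphere and on each section, and then over the random
  subspace.\<close>

lemma section_variance_bound_limit:
  assumes f: "\<And>n. section_variance_bound (f n)"
    and C: "\<And>n x. norm x = 1 \<Longrightarrow> \<bar>f n x\<bar> \<le> C"
    and lim: "\<And>x. norm x = 1 \<Longrightarrow> (\<lambda>n. f n x) \<longlonglongrightarrow> g x"
    and g [measurable]: "g \<in> borel_measurable borel"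
  shows "section_variance_bound g"
proof -
  have fm [measurable]: "f n \<in> borel_measurable borel" "section_mean (f n) \<in> borel_measurable M" for n
    using f[of n] by (auto simp: section_variance_bound_def)
  \<comment> \<open>Stated for any invariant measure and continuous \<open>h\<close>, so that it
    serves the sphere and the sections, first and second moments alike.\<close>
  have conv: "(\<lambda>n. \<integral>x. h (f n x) \<partial>\<mu>) \<longlonglongrightarrow> (\<integral>x. h (g x) \<partial>\<mu>)"
    if inv: "rotation_invariant_on_sphere K \<mu>" and h: "continuous_on UNIV h"
      and B: "\<And>y. \<bar>y\<bar> \<le> C \<Longrightarrow> \<bar>h y\<bar> \<le> B" for K \<mu> B and h :: "real \<Rightarrow> real"
  proof -
    interpret S: prob_space \<mu> by (rule rotation_invariant_prob_space[OF inv])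
    have n1: "norm x = 1" if "x \<in> space \<mu>" for x
      using that by (simp add: space_rotation_invariant[OF inv])
    have [measurable]: "h \<in> borel_measurable borel" by (rule borel_measurable_continuous_onI[OF h])
    show ?thesis
    proof (rule integral_dominated_convergence[where w = "\<lambda>_. B"])
      show "(\<lambda>x. h (g x)) \<in> borel_measurable \<mu>" "(\<lambda>x. h (f n x)) \<in> borel_measurable \<mu>" for n
        by (intro measurable_rotation_invariant[OF inv]; measurable)+
      show "AE x in \<mu>. (\<lambda>n. h (f n x)) \<longlonglongrightarrow> h (g x)"
        using n1 lim by (intro AE_I2 continuous_on_tendsto_compose[OF h]) auto
      show "AE x in \<mu>. norm (h (f n x)) \<le> B" for n
        using n1 C B by (intro AE_I2) simp
    qed simp
  qed
  have C2: "\<bar>y\<^sup>2\<bar> \<le> C\<^sup>2" if "\<bar>y\<bar> \<le> C" for y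
    using power_mono[OF that abs_ge_zero, of 2] by simp
  have lim1: "(\<lambda>n. \<integral>x. f n x \<partial>\<sigma>) \<longlonglongrightarrow> (\<integral>x. g x \<partial>\<sigma>)"
    by (rule conv[OF sphere, of "\<lambda>y. y" C]) (auto intro: continuous_intros)
  have lim2: "(\<lambda>n. \<integral>x. (f n x)\<^sup>2 \<partial>\<sigma>) \<longlonglongrightarrow> (\<integral>x. (g x)\<^sup>2 \<partial>\<sigma>)"
    by (rule conv[OF sphere, of "\<lambda>y. y\<^sup>2" "C\<^sup>2"]) (intro continuous_intros, erule C2)
  have limT: "(\<lambda>n. section_mean (f n) \<omega>) \<longlonglongrightarrow> section_mean g \<omega>" if "\<omega> \<in> space M" for \<omega>
    unfolding section_mean_def
    by (rule conv[OF section_inv[OF H_grassmannian[OF that]], of "\<lambda>y. y" C]) (auto intro: continuous_intros)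
  have bT: "\<bar>section_mean (f n) \<omega>\<bar> \<le> C" if "\<omega> \<in> space M" for n \<omega>
    using that C by (intro section_mean_bound) auto
  have gT [measurable]: "section_mean g \<in> borel_measurable M"
    by (rule borel_measurable_LIMSEQ_real[OF limT]) measurable
  have limE: "(\<lambda>n. expectation (section_mean (f n))) \<longlonglongrightarrow> expectation (section_mean g)"
    by (rule integral_dominated_convergence[where w = "\<lambda>_. C"]) (auto intro!: AE_I2 limT bT)
  have limE2: "(\<lambda>n. expectation (\<lambda>\<omega>. (section_mean (f n) \<omega>)\<^sup>2)) \<longlonglongrightarrow> expectation (\<lambda>\<omega>. (section_mean g \<omega>)\<^sup>2)"
  proof (rule integral_dominated_convergence[where w = "\<lambda>_. C\<^sup>2"])
    show "AE \<omega> in M. (\<lambda>n. (section_mean (f n) \<omega>)\<^sup>2) \<longlonglongrightarrow> (section_mean g \<omega>)\<^sup>2"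
      by (intro AE_I2 tendsto_intros limT)
    show "AE \<omega> in M. norm ((section_mean (f n) \<omega>)\<^sup>2) \<le> C\<^sup>2" for n
      using bT C2 by (intro AE_I2) (simp add: abs_le_square_iff)
  qed measurable
  have "expectation (section_mean g) = (\<integral>x. g x \<partial>\<sigma>)"
  proof (rule LIMSEQ_unique[OF limE])
    show "(\<lambda>n. expectation (section_mean (f n))) \<longlonglongrightarrow> (\<integral>x. g x \<partial>\<sigma>)"
      using lim1 f by (simp add: section_variance_bound_def)
  qed
  moreover have "expectation (\<lambda>\<omega>. (section_mean g \<omega>)\<^sup>2) - (\<integral>x. g x \<partial>\<sigma>)\<^sup>2
      \<le> spectral_bound * ((\<integral>x. (g x)\<^sup>2 \<partial>\<sigma>) - (\<integral>x. g x \<partial>\<sigma>)\<^sup>2)"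
  proof (rule LIMSEQ_le)
    show "(\<lambda>n. expectation (\<lambda>\<omega>. (section_mean (f n) \<omega>)\<^sup>2) - (\<integral>x. f n x \<partial>\<sigma>)\<^sup>2)
      \<longlonglongrightarrow> expectation (\<lambda>\<omega>. (section_mean g \<omega>)\<^sup>2) - (\<integral>x. g x \<partial>\<sigma>)\<^sup>2"
      by (intro tendsto_intros limE2 lim1)
    show "(\<lambda>n. spectral_bound * ((\<integral>x. (f n x)\<^sup>2 \<partial>\<sigma>) - (\<integral>x. f n x \<partial>\<sigma>)\<^sup>2))
      \<longlonglongrightarrow> spectral_bound * ((\<integral>x. (g x)\<^sup>2 \<partial>\<sigma>) - (\<integral>x. g x \<partial>\<sigma>)\<^sup>2)"
      by (intro tendsto_intros lim2 lim1)
  qed (use f in \<open>auto simp: section_variance_bound_def\<close>)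
  ultimately show ?thesis
    unfolding section_variance_bound_def using g gT by blast
qed

lemma section_variance_bound_continuous:
  assumes "continuous_on UNIV f"
  shows "section_variance_bound f"
proof -
  have "\<forall>n. \<exists>D g. ridge_poly D g \<and> (\<forall>x\<in>sphere 0 1. \<bar>f x - g x\<bar> < 1 / real (Suc n))"
    by (intro allI continuous_ridge_approx[OF assms]) simp
  from choice[OF this] obtain D where
    "\<forall>n. \<exists>g. ridge_poly (D n) g \<and> (\<forall>x\<in>sphere 0 1. \<bar>f x - g x\<bar> < 1 / real (Suc n))" by blast
  from choice[OF this] obtain g where
    "\<forall>n. ridge_poly (D n) (g n) \<and> (\<forall>x\<in>sphere 0 1. \<bar>f x - g n x\<bar> < 1 / real (Suc n))" by blast
  hence g: "\<And>n. ridge_poly (D n) (g n)" "\<And>n x. norm x = 1 \<Longrightarrow> \<bar>f x - g n x\<bar> < 1 / real (Suc n)"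
    by auto
  obtain C where C: "\<And>x. norm x = 1 \<Longrightarrow> \<bar>f x\<bar> \<le> C"
    using continuous_bounded_on_sphere[OF assms] by blast
  show ?thesis
  proof (rule section_variance_bound_limit[OF section_variance_bound_ridge[OF g(1)]])
    show "\<bar>g n x\<bar> \<le> C + 1" if "norm x = 1" for n x
    proof -
      have "1 / real (Suc n) \<le> 1" by simp
      thus ?thesis using g(2)[OF that, of n] C[OF that] by linarith
    qed
    show "(\<lambda>n. g n x) \<longlonglongrightarrow> f x" if "norm x = 1" for x
    proof (rule LIM_zero_cancel, rule Lim_null_comparison[OF always_eventually])
      show "\<forall>n. norm (g n x - f x) \<le> 1 / real (Suc n)"
        using g(2)[OF that] by (auto simp: abs_minus_commute less_imp_le)
      show "(\<lambda>n. 1 / real (Suc n)) \<longlonglongrightarrow> 0" by (rule LIMSEQ_Suc[OF lim_1_over_n])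
    qed
    show "f \<in> borel_measurable borel" by (rule borel_measurable_continuous_onI[OF assms])
  qed
qed

lemma section_variance_bound_baire: "baire f \<Longrightarrow> section_variance_bound f"
proof (induction rule: baire.induct)
  case (baire_continuous f)
  thus ?case by (rule section_variance_bound_continuous)
next
  case (baire_limit f C g)
  have "g \<in> borel_measurable borel"
    by (rule borel_measurable_LIMSEQ_real[OF baire_limit.hyps(3)])
      (use baire_limit.IH in \<open>simp add: section_variance_bound_def\<close>)
  with baire_limit show ?case
    by (intro section_variance_bound_limit[of f C g]) auto
qed

text \<open>An indicator equals its square, so its variance on the sphere is
  \<open>p - p\<^sup>2\<close> with \<open>p\<close> the measure of \<open>A\<close>; the
  normalisation divides this by \<open>p\<^sup>2\<close>.\<close>

lemma variance_section_measure:
  assumes A: "A \<in> sets \<sigma>" "measure \<sigma> A > 0"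
  shows "variance (\<lambda>\<omega>. measure (\<sigma>\<^sub>H (H \<omega>)) (A \<inter> H \<omega>) / measure \<sigma> A)
    \<le> spectral_bound * (1 / measure \<sigma> A - 1)"
proof -
  let ?p = "measure \<sigma> A" and ?T = "section_mean (indicator A)"
  have A': "A \<in> sets borel" "A \<subseteq> sphere 0 1"
    using A(1) by (auto simp: sets_rotation_invariant[OF sphere] sets_restrict_space)
  have T: "?T \<omega> = measure (\<sigma>\<^sub>H (H \<omega>)) (A \<inter> H \<omega>)" if "\<omega> \<in> space M" for \<omega>
  proof -
    note inv = section_inv[OF H_grassmannian[OF that]]
    have "A \<inter> space (\<sigma>\<^sub>H (H \<omega>)) = A \<inter> H \<omega>"
      using A'(2) by (auto simp: space_rotation_invariant[OF inv])
    thus ?thesis by (simp add: section_mean_def)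
  qed
  have svb: "section_variance_bound (indicator A)"
    by (intro section_variance_bound_baire baire_indicator A')
  have [measurable]: "?T \<in> borel_measurable M"
    using svb by (simp add: section_variance_bound_def)
  have p: "(\<integral>x. indicator A x \<partial>\<sigma>) = ?p"
    using A(1) by (simp add: sets.Int_space_eq2)
  have ET: "expectation ?T = ?p"
    using svb p by (simp add: section_variance_bound_def)
  have "(\<lambda>x. (indicator A x)\<^sup>2) = (indicator A :: 'a \<Rightarrow> real)"
    by (auto simp: indicator_def)
  hence ET2: "expectation (\<lambda>\<omega>. (?T \<omega>)\<^sup>2) - ?p\<^sup>2 \<le> spectral_bound * (?p - ?p\<^sup>2)"
    using svb p unfolding section_variance_bound_def by metis
  have bd: "\<bar>?T \<omega>\<bar> \<le> 1" if "\<omega> \<in> space M" for \<omega>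
    using that A'(1) by (intro section_mean_bound) auto
  have int: "integrable M ?T" "integrable M (\<lambda>\<omega>. (?T \<omega>)\<^sup>2)"
    using bd by (intro integrable_const_bound[of _ 1] AE_I2; simp add: abs_square_le_1)+
  have "variance (\<lambda>\<omega>. measure (\<sigma>\<^sub>H (H \<omega>)) (A \<inter> H \<omega>) / ?p) = variance (\<lambda>\<omega>. ?T \<omega> / ?p)"
    by (simp add: T cong: Bochner_Integration.integral_cong)
  also have "\<dots> = expectation (\<lambda>\<omega>. (?T \<omega> / ?p)\<^sup>2) - (expectation (\<lambda>\<omega>. ?T \<omega> / ?p))\<^sup>2"
    by (rule variance_eq) (use int in \<open>simp_all only: power_divide integrable_divide\<close>)
  also have "\<dots> = expectation (\<lambda>\<omega>. (?T \<omega>)\<^sup>2) / ?p\<^sup>2 - (?p / ?p)\<^sup>2"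
    by (simp only: power_divide integral_divide_zero ET)
  also have "\<dots> = expectation (\<lambda>\<omega>. (?T \<omega>)\<^sup>2) / ?p\<^sup>2 - 1"
    using A(2) by simp
  also have "\<dots> = (expectation (\<lambda>\<omega>. (?T \<omega>)\<^sup>2) - ?p\<^sup>2) / ?p\<^sup>2"
    using A(2) by (simp add: field_simps)
  also have "\<dots> \<le> spectral_bound * (?p - ?p\<^sup>2) / ?p\<^sup>2"
    by (intro divide_right_mono ET2) simp
  also have "\<dots> = spectral_bound * (1 / ?p - 1)"
    using A(2) by (simp add: power2_eq_square field_simps)
  finally show ?thesis .
qed

end

theorem theorem1p4:
  fixes k :: nat
    and A :: "(real ^ 'n) set"
    and \<sigma> :: "(real ^ 'n) measure"
    and \<sigma>\<^sub>H :: "(real ^ 'n) set \<Rightarrow> (real ^ 'n) measure"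
    and M :: "'w measure"
    and H :: "'w \<Rightarrow> (real ^ 'n) set"
  assumes "rotation_invariant_on_sphere UNIV \<sigma>"
    and "\<And>K. K \<in> grassmannian k \<Longrightarrow> rotation_invariant_on_sphere K (\<sigma>\<^sub>H K)"
    and "A \<in> sets \<sigma>" and "measure \<sigma> A > 0"
    and "2 \<le> k" and "k \<le> CARD('n) - 1"
    and "prob_space M" and "random_subspace M k H"
  shows "prob_space.variance M (\<lambda>\<omega>. measure (\<sigma>\<^sub>H (H \<omega>)) (A \<inter> H \<omega>) / measure \<sigma> A)
         \<le> (real CARD('n) - real k) / (real k * (real CARD('n) - 1)) * (1 / measure \<sigma> A - 1)"
proof -
  \<comment> \<open>The subtraction in \<open>k \<le> CARD('n) - 1\<close> is on natural numbers;
    together with \<open>2 \<le> k\<close> it yields the strict inequality.\<close>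
  have k: "1 \<le> k" "k < DIM(real ^ 'n)" using assms(5,6) by simp_all
  interpret random_section k \<sigma> \<sigma>\<^sub>H M H
    by (rule random_section.intro[OF assms(1,2) k assms(7,8)])
  show ?thesis
    using variance_section_measure[OF assms(3,4)] by (simp add: spectral_bound_eq)
qed

end
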